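(* Assume conditions (A) and (B) of the context. Let $\phi(x)=(2\pi)^{-d/2}e^{-|x|^2/2}$ be the standard Gaussian density on $\mathbb{R}^d$ and let $p_1^*$ be the density of $X_1^*$ under $\mathbb{P}^*$. Then $$D_{TV}(\mu_{data},\,p_1^*(x)dx)\le\sqrt{-\frac12D_{KL}(\phi(x)dx\,\|\,p_1(x)dx)+\frac{m_{0,1}^2+m_{0,1}}{4(1-m_{0,1}^2)}\left(d+\mathbb{E}|\mathbf{x}_0|^2\right)}.$$
   Context: Let $d,n\ge 1$ be integers; $|\cdot|$ is the Euclidean norm on vectors and the Frobenius norm on matrices; $\nabla$, $\nabla^2$ are the gradient and Hessian in the spatial variable. $(\Omega,\mathcal{F},\mathbb{P})$ is a complete probability space, $\mu_{data}$ is a Borel probability measure on $\mathbb{R}^d$, $\mathbf{x}_0\sim\mu_{data}$, and $\mathbb{E}$ is expectation under $\mathbb{P}$. For a density $p$, set $\nabla\log p(x)=\nabla p(x)/p(x)$ if $p(x)>0$ and $\nabla\log p(x)=0$ otherwise; likewise $\nabla^2\log p=\nabla^2p/p-(\nabla p)(\nabla p)^{\mathsf T}/p^2$ where $p>0$ and $0$ otherwise. Condition (A): $\mu_{data}$ has a bounded density $p_{data}$ with weak derivatives up to second order on $\mathbb{R}^d$ (the gradient $\nabla p_{data}$ and Hessian $\nabla^2p_{data}$ exist as locally integrable functions), and $|\nabla^2\log p_{data}(x)|+|\nabla\log p_{data}(x)+Qx|\le c_0$ for a.e. $x\in\mathbb{R}^d$, for some constant $c_0>0$ and some symmetric positive definite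 $Q\in\mathbb{R}^{d\times d}$. The constant $c_1>0$ is a given number greater than the maximum eigenvalue of $Q$. Noise schedule: $\alpha_1,\dots,\alpha_n\in(0,1)$, $\bar\alpha_i=\prod_{k=1}^i\alpha_k$, $t_i=i/n$; $\beta:[0,1]\to[0,\infty)$ is the piecewise constant function $\beta_t=-n\log\alpha_i$ for $t\in(t_{i-1},t_i)$, so that $\bar\alpha_i=e^{-\int_0^{t_i}\beta_r\,dr}$. Put $m_{t,r}=e^{-\frac12\int_t^r\beta_u\,du}$, $\sigma_{t,r}=\sqrt{1-m_{t,r}^2}$, $$p(t,x,r,y)=(2\pi\sigma_{t,r}^2)^{-d/2}\exp\left(-\frac{|y-m_{t,r}x|^2}{2\sigma_{t,r}^2}\right),\quad 0\le t<r\le1,$$ and $p_t(y)=\int_{\mathbb{R}^d}p(0,x,t,y)\mu_{data}(dx)$ for $0<t\le1$, $p_0=p_{data}$. Thus $p_t$ is the density of $X_t$, where $dX_t=-\frac12\beta_tX_t\,dt+\sqrt{\beta_t}\,dW_t$, $X_0=\mathbf{x}_0$, with $W$ a $d$-dimensional Brownian motion independent of $\mathbf{x}_0$. Condition (B): $z_1,\dots,z_n:\mathbb{R}^d\to\mathbb{R}^d$ are Borel measurable functions (the denoising terms), and the estimated scores $\mathbf{s}_i(x)=-\frac{1}{\sqrt{1-\bar\alpha_i}}z_i(x)$ satisfy $|\mathbf{s}_i(x)|\le\frac{c_0}{\sqrt{\bar\alpha_i}}+\frac{c_1}{\bar\alpha_i}|x|$ for a.e. $x\in\mathbb{R}^d$,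 $i=1,\dots,n$, with the same $c_0,c_1$ as in condition (A). Reverse process: $(\Omega,\mathcal{F},\mathbb{F}^*,\mathbb{P}^*,W^*,X^* )$ is a weak solution of $$dX^*_t=\left[\tfrac12\beta_{1-t}X^*_t+\beta_{1-t}\nabla\log p_{1-t}(X^*_t)\right]dt+\sqrt{\beta_{1-t}}\,dW^*_t,\quad 0\le t\le1,\quad X^*_0\sim N(0,I_d)\text{ under }\mathbb{P}^*,$$ where $W^*$ is a $d$-dimensional $\mathbb{F}^*$-Brownian motion under $\mathbb{P}^*$ and $X^*$ is continuous and $\mathbb{F}^*$-adapted, whose transition density under $\mathbb{P}^*$ is $$p^*(t,x,r,y)=e^{\frac d2\int_t^r\beta_{1-u}du}\,\frac{p_{1-r}(y)}{p_{1-t}(x)}\,q(t,x,r,y),\quad q(t,x,r,y)=\frac{m_{1-r,1-t}^d}{(2\pi\sigma_{1-r,1-t}^2)^{d/2}}\exp\left(-\frac{m_{1-r,1-t}^2}{2\sigma_{1-r,1-t}^2}\left|y-\frac{x}{m_{1-r,1-t}}\right|^2\right),$$ for $0\le t<r\le 1$. For Borel probability measures $\mu,\nu$ on $\mathbb{R}^d$, the total variation distance is $$D_{TV}(\mu,\nu)=\sup_{\|f\|_\infty\le1}\left|\int_{\mathbb{R}^d}f(x)(\mu-\nu)(dx)\right|,\qquad \|f\|_\infty=\sup_{x\in\mathbb{R}^d}|f(x)|,$$ the supremum being over Borel measurable $f:\mathbb{R}^d\to\mathbb{R}$, and $D_{KL}(\mu\,\|\,\nu)$ is the Kullback-Leibler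 divergence (relative entropy) of $\mu$ with respect to $\nu$. *)

theory Defs
  imports "HOL-Probability.Probability"
begin

section \<open>Weak derivatives and logarithmic derivatives\<close>

definition partial_deriv :: "'d::finite \<Rightarrow> (real^'d \<Rightarrow> real) \<Rightarrow> real^'d \<Rightarrow> real" where
  "partial_deriv i f x = frechet_derivative f (at x) (axis i 1)"

definition grad :: "(real^'d::finite \<Rightarrow> real) \<Rightarrow> real^'d \<Rightarrow> real^'d" where
  "grad f x = (\<chi> i. partial_deriv i f x)"

fun C_k :: "nat \<Rightarrow> (real^'d::finite \<Rightarrow> real) \<Rightarrow> bool" where
  "C_k 0 f \<longleftrightarrow> continuous_on UNIV f"
| "C_k (Suc k) f \<longleftrightarrow> (\<forall>x. f differentiable (at x)) \<and> (\<forall>i. C_k k (partial_deriv i f))"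

definition test_function :: "(real^'d::finite \<Rightarrow> real) \<Rightarrow> bool" where
  "test_function \<psi> \<longleftrightarrow> (\<forall>k. C_k k \<psi>) \<and> compact (closure {x. \<psi> x \<noteq> 0})"

definition locally_integrable :: "(real^'d::finite \<Rightarrow> 'b::{banach, second_countable_topology}) \<Rightarrow> bool" where
  "locally_integrable f \<longleftrightarrow> (\<forall>K. compact K \<longrightarrow> set_integrable lborel K f)"

definition is_weak_gradient :: "(real^'d::finite \<Rightarrow> real) \<Rightarrow> (real^'d \<Rightarrow> real^'d) \<Rightarrow> bool" where
  "is_weak_gradient p g \<longleftrightarrow> locally_integrable g \<and>
     (\<forall>\<psi> i. test_function \<psi> \<longrightarrow>
        (LINT x|lborel. p x * partial_deriv i \<psi> x) = - (LINT x|lborel. g x $ i * \<psi> x))"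

definition is_weak_hessian :: "(real^'d::finite \<Rightarrow> real) \<Rightarrow> (real^'d \<Rightarrow> real^'d^'d) \<Rightarrow> bool" where
  "is_weak_hessian p H \<longleftrightarrow> locally_integrable H \<and>
     (\<forall>\<psi> i j. test_function \<psi> \<longrightarrow>
        (LINT x|lborel. p x * partial_deriv i (partial_deriv j \<psi>) x) = (LINT x|lborel. H x $ i $ j * \<psi> x))"

text \<open>The logarithmic derivatives take the (weak or classical) gradient \<open>g\<close> and Hessian \<open>H\<close>
  of the density as arguments.\<close>

definition log_grad :: "(real^'d::finite \<Rightarrow> real) \<Rightarrow> (real^'d \<Rightarrow> real^'d) \<Rightarrow> real^'d \<Rightarrow> real^'d" where
  "log_grad p g x = (if p x > 0 then g x /\<^sub>R p x else 0)"

definition log_hess ::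
  "(real^'d::finite \<Rightarrow> real) \<Rightarrow> (real^'d \<Rightarrow> real^'d) \<Rightarrow> (real^'d \<Rightarrow> real^'d^'d) \<Rightarrow> real^'d \<Rightarrow> real^'d^'d" where
  "log_hess p g H x =
     (if p x > 0 then H x /\<^sub>R p x - (\<chi> i j. g x $ i * g x $ j) /\<^sub>R (p x)\<^sup>2 else 0)"

section \<open>The conditions on the data distribution and on the estimated scores\<close>

definition sym_pos_def :: "real^'d::finite^'d \<Rightarrow> bool" where
  "sym_pos_def Q \<longleftrightarrow> transpose Q = Q \<and> (\<forall>x. x \<noteq> 0 \<longrightarrow> x \<bullet> (Q *v x) > 0)"

text \<open>The library norm on \<^typ>\<open>real^'d^'d\<close> is the Frobenius norm.\<close>

definition condition_A ::
  "(real^'d::finite) measure \<Rightarrow> (real^'d \<Rightarrow> real) \<Rightarrow> (real^'d \<Rightarrow> real^'d) \<Rightarrow> (real^'d \<Rightarrow> real^'d^'d)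
     \<Rightarrow> real^'d^'d \<Rightarrow> real \<Rightarrow> bool" where
  "condition_A \<mu> p g H Q c0 \<longleftrightarrow>
     p \<in> borel_measurable borel \<and> (\<forall>x. 0 \<le> p x) \<and> (\<exists>C. \<forall>x. p x \<le> C) \<and>
     \<mu> = density lborel (\<lambda>x. ennreal (p x)) \<and>
     is_weak_gradient p g \<and> is_weak_hessian p H \<and>
     sym_pos_def Q \<and> c0 > 0 \<and>
     (AE x in lborel. norm (log_hess p g H x) + norm (log_grad p g x + Q *v x) \<le> c0)"

definition alpha_bar :: "(nat \<Rightarrow> real) \<Rightarrow> nat \<Rightarrow> real" where
  "alpha_bar \<alpha> i = (\<Prod>k=1..i. \<alpha> k)"

definition estimated_score :: "(nat \<Rightarrow> real) \<Rightarrow> (nat \<Rightarrow> real^'d::finite \<Rightarrow> real^'d) \<Rightarrow> nat \<Rightarrow> real^'d \<Rightarrow> real^'d" where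
  "estimated_score \<alpha> z i x = - (1 / sqrt (1 - alpha_bar \<alpha> i)) *\<^sub>R z i x"

definition condition_B ::
  "nat \<Rightarrow> (nat \<Rightarrow> real) \<Rightarrow> (nat \<Rightarrow> real^'d::finite \<Rightarrow> real^'d) \<Rightarrow> real \<Rightarrow> real \<Rightarrow> bool" where
  "condition_B n \<alpha> z c0 c1 \<longleftrightarrow>
     (\<forall>i\<in>{1..n}. z i \<in> borel_measurable borel \<and>
        (AE x in lborel. norm (estimated_score \<alpha> z i x)
            \<le> c0 / sqrt (alpha_bar \<alpha> i) + c1 / alpha_bar \<alpha> i * norm x))"

section \<open>Noise schedule and forward densities\<close>

text \<open>The value of \<open>\<beta>\<close> at the grid points \<open>i/n\<close> plays no role; the left-continuous version is
  chosen.\<close>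

definition noise_rate :: "nat \<Rightarrow> (nat \<Rightarrow> real) \<Rightarrow> real \<Rightarrow> real" where
  "noise_rate n \<alpha> t = (if 0 < t \<and> t \<le> 1 then - real n * ln (\<alpha> (nat \<lceil>real n * t\<rceil>)) else 0)"

definition mean_factor :: "nat \<Rightarrow> (nat \<Rightarrow> real) \<Rightarrow> real \<Rightarrow> real \<Rightarrow> real" where
  "mean_factor n \<alpha> t r = exp (- (1/2) * (LINT u:{t..r}|lborel. noise_rate n \<alpha> u))"

definition std_factor :: "nat \<Rightarrow> (nat \<Rightarrow> real) \<Rightarrow> real \<Rightarrow> real \<Rightarrow> real" where
  "std_factor n \<alpha> t r = sqrt (1 - (mean_factor n \<alpha> t r)\<^sup>2)"

definition gauss_density :: "real \<Rightarrow> real^'d::finite \<Rightarrow> real" where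
  "gauss_density v y = (2 * pi * v) powr (- real CARD('d) / 2) * exp (- (norm y)\<^sup>2 / (2 * v))"

definition forward_kernel ::
  "nat \<Rightarrow> (nat \<Rightarrow> real) \<Rightarrow> real \<Rightarrow> real^'d::finite \<Rightarrow> real \<Rightarrow> real^'d \<Rightarrow> real" where
  "forward_kernel n \<alpha> t x r y =
     gauss_density ((std_factor n \<alpha> t r)\<^sup>2) (y - mean_factor n \<alpha> t r *\<^sub>R x)"

definition forward_density ::
  "nat \<Rightarrow> (nat \<Rightarrow> real) \<Rightarrow> (real^'d::finite) measure \<Rightarrow> (real^'d \<Rightarrow> real) \<Rightarrow> real \<Rightarrow> real^'d \<Rightarrow> real" where
  "forward_density n \<alpha> \<mu> p t y = (if t = 0 then p y else (LINT x|\<mu>. forward_kernel n \<alpha> 0 x t y))"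

text \<open>At positive times the density is smooth and its classical gradient is used; at time 0 it is
  the data density, whose gradient is the weak gradient \<open>g\<close>.\<close>

definition forward_score ::
  "nat \<Rightarrow> (nat \<Rightarrow> real) \<Rightarrow> (real^'d::finite) measure \<Rightarrow> (real^'d \<Rightarrow> real) \<Rightarrow> (real^'d \<Rightarrow> real^'d)
     \<Rightarrow> real \<Rightarrow> real^'d \<Rightarrow> real^'d" where
  "forward_score n \<alpha> \<mu> p g t =
     log_grad (forward_density n \<alpha> \<mu> p t) (if t = 0 then g else grad (forward_density n \<alpha> \<mu> p t))"

section \<open>The reverse process\<close>

definition filtration_on :: "'a measure \<Rightarrow> (real \<Rightarrow> 'a measure) \<Rightarrow> bool" where
  "filtration_on M F \<longleftrightarrow>
     (\<forall>t\<in>{0..1}. subalgebra M (F t)) \<and> (\<forall>s\<in>{0..1}. \<forall>t\<in>{0..1}. s \<le> t \<longrightarrow> sets (F s) \<subseteq> sets (F t))"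

definition brownian_motion_on ::
  "'a measure \<Rightarrow> (real \<Rightarrow> 'a measure) \<Rightarrow> (real \<Rightarrow> 'a \<Rightarrow> real^'d::finite) \<Rightarrow> bool" where
  "brownian_motion_on M F W \<longleftrightarrow>
     (\<forall>t\<in>{0..1}. W t \<in> borel_measurable (F t)) \<and>
     (AE \<omega> in M. W 0 \<omega> = 0) \<and>
     (AE \<omega> in M. continuous_on {0..1} (\<lambda>t. W t \<omega>)) \<and>
     (\<forall>s\<in>{0..1}. \<forall>t\<in>{0..1}. s < t \<longrightarrow>
        distributed M lborel (\<lambda>\<omega>. W t \<omega> - W s \<omega>) (\<lambda>y. ennreal (gauss_density (t - s) y)) \<and>
        prob_space.indep_set M (sets (F s))
          {(\<lambda>\<omega>. W t \<omega> - W s \<omega>) -` B \<inter> space M | B. B \<in> sets borel})"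

text \<open>The integrand \<open>s \<mapsto> sqrt (\<beta> (1 - s))\<close> is deterministic and piecewise constant, with value
  \<open>sqrt (- n ln (\<alpha> i))\<close> on the interval from \<open>1 - i/n\<close> to \<open>1 - (i-1)/n\<close>. Hence its
  Ito integral over \<open>[0, t]\<close> is, by the definition for simple integrands, the following sum.\<close>

definition diffusion_integral ::
  "nat \<Rightarrow> (nat \<Rightarrow> real) \<Rightarrow> (real \<Rightarrow> 'a \<Rightarrow> real^'d::finite) \<Rightarrow> real \<Rightarrow> 'a \<Rightarrow> real^'d" where
  "diffusion_integral n \<alpha> W t \<omega> =
     (\<Sum>i=1..n. sqrt (- real n * ln (\<alpha> i)) *\<^sub>R
        (W (min t (1 - (real i - 1) / real n)) \<omega> - W (min t (1 - real i / real n)) \<omega>))"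

definition reverse_drift ::
  "nat \<Rightarrow> (nat \<Rightarrow> real) \<Rightarrow> (real^'d::finite) measure \<Rightarrow> (real^'d \<Rightarrow> real) \<Rightarrow> (real^'d \<Rightarrow> real^'d)
     \<Rightarrow> real \<Rightarrow> real^'d \<Rightarrow> real^'d" where
  "reverse_drift n \<alpha> \<mu> p g t x =
     (1/2 * noise_rate n \<alpha> (1 - t)) *\<^sub>R x +
     noise_rate n \<alpha> (1 - t) *\<^sub>R forward_score n \<alpha> \<mu> p g (1 - t) x"

definition reverse_weak_solution ::
  "nat \<Rightarrow> (nat \<Rightarrow> real) \<Rightarrow> (real^'d::finite) measure \<Rightarrow> (real^'d \<Rightarrow> real) \<Rightarrow> (real^'d \<Rightarrow> real^'d)
     \<Rightarrow> 'a measure \<Rightarrow> (real \<Rightarrow> 'a measure) \<Rightarrow> (real \<Rightarrow> 'a \<Rightarrow> real^'d) \<Rightarrow> (real \<Rightarrow> 'a \<Rightarrow> real^'d) \<Rightarrow> bool" where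
  "reverse_weak_solution n \<alpha> \<mu> p g M F W X \<longleftrightarrow>
     prob_space M \<and> filtration_on M F \<and> brownian_motion_on M F W \<and>
     (\<forall>t\<in>{0..1}. X t \<in> borel_measurable (F t)) \<and>
     (AE \<omega> in M. continuous_on {0..1} (\<lambda>t. X t \<omega>)) \<and>
     distributed M lborel (X 0) (\<lambda>y. ennreal (gauss_density 1 y)) \<and>
     (AE \<omega> in M. set_integrable lborel {0..1} (\<lambda>s. reverse_drift n \<alpha> \<mu> p g s (X s \<omega>))) \<and>
     (AE \<omega> in M. \<forall>t\<in>{0..1}.
        X t \<omega> = X 0 \<omega> + (LINT s:{0..t}|lborel. reverse_drift n \<alpha> \<mu> p g s (X s \<omega>))
                + diffusion_integral n \<alpha> W t \<omega>)"

definition reverse_q ::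
  "nat \<Rightarrow> (nat \<Rightarrow> real) \<Rightarrow> real \<Rightarrow> real^'d::finite \<Rightarrow> real \<Rightarrow> real^'d \<Rightarrow> real" where
  "reverse_q n \<alpha> t x r y =
     (let m = mean_factor n \<alpha> (1 - r) (1 - t); \<sigma> = std_factor n \<alpha> (1 - r) (1 - t) in
        m ^ CARD('d) / (2 * pi * \<sigma>\<^sup>2) powr (real CARD('d) / 2) *
        exp (- (m\<^sup>2 / (2 * \<sigma>\<^sup>2)) * (norm (y - x /\<^sub>R m))\<^sup>2))"

definition reverse_kernel ::
  "nat \<Rightarrow> (nat \<Rightarrow> real) \<Rightarrow> (real^'d::finite) measure \<Rightarrow> (real^'d \<Rightarrow> real)
     \<Rightarrow> real \<Rightarrow> real^'d \<Rightarrow> real \<Rightarrow> real^'d \<Rightarrow> real" where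
  "reverse_kernel n \<alpha> \<mu> p t x r y =
     exp (real CARD('d) / 2 * (LINT u:{t..r}|lborel. noise_rate n \<alpha> (1 - u))) *
     (forward_density n \<alpha> \<mu> p (1 - r) y / forward_density n \<alpha> \<mu> p (1 - t) x) *
     reverse_q n \<alpha> t x r y"

definition has_transition_density ::
  "'a measure \<Rightarrow> (real \<Rightarrow> 'a measure) \<Rightarrow> (real \<Rightarrow> 'a \<Rightarrow> real^'d::finite)
     \<Rightarrow> (real \<Rightarrow> real^'d \<Rightarrow> real \<Rightarrow> real^'d \<Rightarrow> real) \<Rightarrow> bool" where
  "has_transition_density M F X k \<longleftrightarrow>
     (\<forall>t r B. 0 \<le> t \<and> t < r \<and> r \<le> 1 \<and> B \<in> sets borel \<longrightarrow>
        (AE \<omega> in M. real_cond_exp M (F t) (\<lambda>\<omega>'. indicator B (X r \<omega>')) \<omega>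
                      = (LINT y:B|lborel. k t (X t \<omega>) r y)))"

section \<open>Distances between distributions\<close>

text \<open>With test functions bounded by 1 in absolute value, this is twice the supremum of
  \<open>\<bar>\<mu> B - \<nu> B\<bar>\<close> over Borel sets \<open>B\<close>.\<close>

definition D_TV :: "(real^'d::finite) measure \<Rightarrow> (real^'d) measure \<Rightarrow> real" where
  "D_TV \<mu> \<nu> = (SUP f \<in> {f \<in> borel_measurable borel. \<forall>x. \<bar>f x\<bar> \<le> 1}. \<bar>(LINT x|\<mu>. f x) - (LINT x|\<nu>. f x)\<bar>)"

text \<open>The library's \<^const>\<open>KL_divergence\<close> takes the base of the logarithm first and integrates with
  respect to its last argument, so the arguments are swapped.\<close>

definition D_KL :: "'a measure \<Rightarrow> 'a measure \<Rightarrow> real" where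
  "D_KL \<mu> \<nu> = KL_divergence (exp 1) \<nu> \<mu>"

end

theory Submission
  imports Defs
begin

text \<open>The transition density of the reverse process from time 0 to time 1 is Bayes' rule: it maps a
  point \<open>x\<close> to the posterior law of \<open>x0\<close> given \<open>X_1 = x\<close> in the forward process, with density
  \<open>s(x, y) = p(0, y, 1, x) / p_1(x)\<close> with respect to \<open>\<mu>\<close>. Hence the law of the reverse process
  at time 1 is the mixture of these posteriors over \<open>x ~ \<phi>\<close>, whereas \<open>\<mu>\<close> is their mixture
  over \<open>x ~ p_1\<close>. With \<open>K = KL(\<phi> | p_1)\<close> and \<open>D\<close> the total variation distance
  (in the normalisation \<open>D \<le> 2\<close>), Pinsker's inequality is used twice. Comparing the mixing laws
  gives \<open>D\<^sup>2 \<le> 2 K\<close>. Comparing \<open>\<mu>\<close> with each posterior, that is, \<open>1\<close> with \<open>s\<close>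
  under \<open>\<phi> \<otimes> \<mu>\<close>, gives \<open>D\<^sup>2 \<le> 2 E[- ln s] = B - 2 K\<close>, where
  \<open>B = d (ln (1 - m\<^sup>2) + m\<^sup>2 / (1 - m\<^sup>2)) + m\<^sup>2 / (1 - m\<^sup>2) E|x0|\<^sup>2\<close> is explicit because
  \<open>ln p(0, y, 1, x)\<close> is quadratic. Suitable averages of these two bounds and of \<open>D \<le> 2\<close>
  produce the term \<open>- K / 2\<close> and the claim.

  The expectation of \<open>|x0|\<^sup>2\<close> is finite by condition (A): the weak gradient is tested against
  truncations of the field \<open>x \<mapsto> x\<close>.\<close>

section \<open>Elementary inequalities\<close>

lemma pinsker_pointwise:
  fixes s :: real
  assumes "s > 0"
  shows "3 * (1 - s)\<^sup>2 \<le> (2 + 4 * s) * (s - 1 - ln s)"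
proof -
  \<comment> \<open>\<open>h\<close> is the difference of the two sides divided by
    \<open>2 + 4 * t\<close>. It vanishes at 1, and \<open>h'\<close> has the sign of
    \<open>t - 1\<close> for positive \<open>t\<close>, so the minimum is at 1.\<close>
  define h :: "real \<Rightarrow> real" where "h t = t - 1 - ln t - 3 * (1 - t)\<^sup>2 / (2 + 4 * t)" for t
  define h' :: "real \<Rightarrow> real" where "h' t = (t - 1) ^ 3 / (t * (1 + 2 * t)\<^sup>2)" for t
  have der: "(h has_real_derivative h' t) (at t)" if "t > 0" for t
  proof -
    have "(h has_real_derivative
        1 - 1 / t - (3 * (2 * (1 - t) * (-1)) * (2 + 4 * t) - 3 * (1 - t)\<^sup>2 * 4) / (2 + 4 * t)\<^sup>2) (at t)"
      unfolding h_def using that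
      by (auto intro!: derivative_eq_intros simp: power2_eq_square)
    also have "1 - 1 / t - (3 * (2 * (1 - t) * (-1)) * (2 + 4 * t) - 3 * (1 - t)\<^sup>2 * 4) / (2 + 4 * t)\<^sup>2 = h' t"
    proof -
      have nz: "t \<noteq> 0" "1 + 2 * t \<noteq> 0" using that by auto
      have "(2 + 4 * t)\<^sup>2 = 4 * (1 + 2 * t)\<^sup>2" by (simp add: power2_eq_square algebra_simps)
      moreover have "1 - 1 / t - (3 * (2 * (1 - t) * (-1)) * (2 + 4 * t) - 3 * (1 - t)\<^sup>2 * 4) / (4 * (1 + 2 * t)\<^sup>2) = h' t"
        unfolding h'_def using nz
        apply (simp add: divide_simps)
        apply (simp add: power2_eq_square power3_eq_cube)
        by algebra
      ultimately show ?thesis by simp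
    qed
    finally show ?thesis .
  qed
  have "h s \<ge> h 1"
  proof (cases "s \<ge> 1")
    case True
    show ?thesis
    proof (rule DERIV_nonneg_imp_nondecreasing[OF True])
      fix x :: real assume "1 \<le> x" "x \<le> s"
      then show "\<exists>y. DERIV h x :> y \<and> 0 \<le> y"
        using der[of x] by (intro exI[of _ "h' x"]) (auto simp: h'_def)
    qed
  next
    case False
    show ?thesis
    proof (rule DERIV_nonpos_imp_nonincreasing[of s 1])
      fix x :: real assume "s \<le> x" "x \<le> 1"
      then have "x > 0" "(x - 1) ^ 3 \<le> 0" using assms by (auto simp: power3_eq_cube mult_nonneg_nonpos zero_le_mult_iff mult_le_0_iff)
      then show "\<exists>y. DERIV h x :> y \<and> y \<le> 0"
        using der[of x] by (intro exI[of _ "h' x"]) (auto simp: h'_def divide_nonpos_nonneg)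
    qed (use False in auto)
  qed
  then have "3 * (1 - s)\<^sup>2 / (2 + 4 * s) \<le> s - 1 - ln s" by (simp add: h_def)
  then show ?thesis using assms by (simp add: divide_le_eq mult.commute)
qed

text \<open>With \<open>s\<close> the density of a second law, the right-hand side is twice the
  relative entropy of \<open>M\<close> with respect to that law. The pointwise inequality reads
  \<open>(1 - s)\<^sup>2 \<le> a * b\<close> with factors of mean 2 and \<open>K\<close>. In place
  of Cauchy-Schwarz, the arithmetic-geometric mean inequality is used with a free parameter
  \<open>c\<close>.\<close>

lemma (in prob_space) pinsker:
  fixes s :: "'a \<Rightarrow> real"
  assumes pos: "\<And>x. s x > 0" and s: "integrable M s" "expectation s = 1"
    and ln: "integrable M (\<lambda>x. ln (s x))"
  shows "(expectation (\<lambda>x. \<bar>1 - s x\<bar>))\<^sup>2 \<le> 2 * expectation (\<lambda>x. - ln (s x))"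
proof -
  define T where "T = expectation (\<lambda>x. \<bar>1 - s x\<bar>)"
  define K where "K = expectation (\<lambda>x. - ln (s x))"
  have T0: "0 \<le> T" unfolding T_def by (intro integral_nonneg_AE) auto
  have key: "T \<le> c + K / (2 * c)" if c: "c > 0" for c
  proof -
    have pt: "\<bar>1 - s x\<bar> \<le> 1 / 2 * (c * (2 + 4 * s x) / 3 + (s x - 1 - ln (s x)) / c)" for x
    proof -
      define a where "a = (2 + 4 * s x) / 3"
      define b where "b = s x - 1 - ln (s x)"
      have a: "a > 0" using pos[of x] by (simp add: a_def)
      have ab: "(1 - s x)\<^sup>2 \<le> a * b" using pinsker_pointwise[OF pos[of x]] by (simp add: a_def b_def)
      have "0 \<le> (c * a - b / c)\<^sup>2" by simp
      then have "4 * (a * b) \<le> (c * a + b / c)\<^sup>2" using c by (simp add: power2_eq_square field_simps)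
      with ab have "(2 * \<bar>1 - s x\<bar>)\<^sup>2 \<le> (c * a + b / c)\<^sup>2" by (simp add: power_mult_distrib)
      moreover have "0 \<le> c * a + b / c"
        using ln_le_minus_one[OF pos[of x]] a c by (simp add: b_def)
      ultimately have "2 * \<bar>1 - s x\<bar> \<le> c * a + b / c" by (rule power2_le_imp_le)
      then show ?thesis by (simp add: a_def b_def)
    qed
    have "T \<le> expectation (\<lambda>x. 1 / 2 * (c * (2 + 4 * s x) / 3 + (s x - 1 - ln (s x)) / c))"
      unfolding T_def using s ln pt by (intro integral_mono) auto
    also have "\<dots> = 1 / 2 * (c * (2 + 4 * 1) / 3 + (1 - 1 + K) / c)"
      using s ln by (simp add: K_def prob_space)
    finally show ?thesis by simp
  qed
  have K0: "0 \<le> K"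
  proof -
    have "expectation (\<lambda>x. ln (s x)) \<le> expectation (\<lambda>x. s x - 1)"
      using s ln ln_le_minus_one[OF pos] by (intro integral_mono) auto
    then show ?thesis using s ln by (simp add: K_def prob_space)
  qed
  have "T\<^sup>2 \<le> 2 * K"
  proof (cases "K = 0")
    \<comment> \<open>For \<open>K = 0\<close> no positive \<open>c\<close> is optimal; letting
      \<open>c\<close> tend to 0 gives \<open>T \<le> 0\<close>.\<close>
    case True
    have "T \<le> 0" by (rule field_le_epsilon) (use key True in auto)
    then show ?thesis using T0 True by simp
  next
    case False
    \<comment> \<open>The minimiser of \<open>c + K / (2 * c)\<close>, at which the two terms are
      equal.\<close>
    define c where "c = sqrt (K / 2)"
    have c: "c > 0" and c2: "K = 2 * c\<^sup>2" using False K0 by (auto simp: c_def)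
    have "T \<le> 2 * c" using key[OF c] c unfolding c2 by (simp add: power2_eq_square)
    then have "T\<^sup>2 \<le> (2 * c)\<^sup>2" using T0 by (rule power_mono)
    then show ?thesis using c2 by (simp add: power_mult_distrib)
  qed
  then show ?thesis by (simp add: T_def K_def)
qed

text \<open>The inequality \<open>ln_one_minus_square_bound\<close> below is tightest near \<open>m = 0.85\<close>, where
  \<open>- ln (1 - m\<^sup>2)\<close> is close to \<open>5/4\<close>; it is proved with the tangent of \<open>ln\<close> there.\<close>

lemma exp_five_quarters_le: "exp (5/4 :: real) \<le> 7/2"
proof (rule power_le_imp_le_base[where n = 3])
  \<comment> \<open>Fourth powers reduce the claim to \<open>e < 2.72\<close>:
    \<open>2.72 ^ 5\<close> is about 148.9 and \<open>(7/2) ^ 4\<close> about 150.1.\<close>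
  have "exp (5/4 :: real) ^ 4 = exp 1 ^ 5"
    by (simp flip: exp_of_nat_mult)
  also have "\<dots> \<le> 2.72 ^ 5" using e_less_272 by (intro power_mono) auto
  also have "\<dots> \<le> (7/2) ^ 4" by (simp add: power_divide)
  finally show "exp (5/4 :: real) ^ Suc 3 \<le> (7/2) ^ Suc 3" by simp
qed simp

lemma ln_one_minus_square_bound:
  fixes m :: real
  assumes "2/3 \<le> m" "m < 1"
  shows "4 * (3 * m - 2) \<le> - ln (1 - m\<^sup>2) * (1 + m)"
proof -
  have pos: "0 < 1 - m\<^sup>2" using assms by (simp add: abs_square_less_1)
  have "ln (1 - m\<^sup>2) + 5/4 = ln ((1 - m\<^sup>2) * exp (5/4))" using pos by (simp add: ln_mult)
  also have "\<dots> \<le> (1 - m\<^sup>2) * exp (5/4) - 1" using pos by (intro ln_le_minus_one) simp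
  also have "\<dots> \<le> (1 - m\<^sup>2) * (7/2) - 1" using mult_left_mono[OF exp_five_quarters_le, of "1 - m\<^sup>2"] pos by simp
  finally have "- ln (1 - m\<^sup>2) \<ge> 9/4 - 7/2 * (1 - m\<^sup>2)" by linarith
  then have "- ln (1 - m\<^sup>2) * (1 + m) \<ge> (9/4 - 7/2 * (1 - m\<^sup>2)) * (1 + m)"
    using assms by (intro mult_right_mono) auto
  \<comment> \<open>Division of the cubic by the square of \<open>m - 17/20\<close>, near which it
    almost has a double root. The linear remainder is positive from 2/3 on.\<close>
  moreover have "(9/4 - 7/2 * (1 - m\<^sup>2)) * (1 + m) - 4 * (3 * m - 2)
      = 7/2 * ((m + 27/10) * (m - 17/20)\<^sup>2) + 229/800 * m - 621/8000"
    by (simp add: power2_eq_square field_simps)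
  moreover have "(m + 27/10) * (m - 17/20)\<^sup>2 \<ge> 0" using assms by simp
  ultimately show ?thesis using assms by linarith
qed

text \<open>Averaging the last two bounds on \<open>D\<^sup>2\<close> with weights \<open>3/8, 5/8\<close>, or the first and the
  third with weights \<open>3/4, 1/4\<close>, gives \<open>D\<^sup>2 + K / 2 \<le> 5/8 * B\<close> and
  \<open>D\<^sup>2 + K / 2 \<le> 3 + B / 4\<close>. For all \<open>m\<close>, \<open>d\<close>, \<open>M\<close> one of the two suffices.\<close>

lemma combine_bounds:
  fixes m d M K D B :: real
  assumes m: "0 < m" "m < 1" and d: "1 \<le> d" and M: "0 \<le> M"
    and D: "D\<^sup>2 \<le> 4" "D\<^sup>2 \<le> 2 * K" "D\<^sup>2 \<le> B - 2 * K"
    and B: "B = d * (ln (1 - m\<^sup>2) + m\<^sup>2 / (1 - m\<^sup>2)) + m\<^sup>2 * M / (1 - m\<^sup>2)"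
  shows "D\<^sup>2 \<le> - (1/2) * K + (m\<^sup>2 + m) / (4 * (1 - m\<^sup>2)) * (d + M)"
proof -
  define v where "v = 1 - m\<^sup>2"
  define L where "L = - ln v"
  have v: "0 < v" "v < 1" using m by (simp_all add: v_def abs_square_less_1)
  have "ln v \<le> v - 1" using v by (intro ln_le_minus_one) auto
  then have L: "m\<^sup>2 \<le> L" by (simp add: L_def v_def)
  have Bv: "v * B = d * (m\<^sup>2 - v * L) + m\<^sup>2 * M"
    using v unfolding B L_def v_def[symmetric] by (simp add: field_simps)
  have cvt: "D\<^sup>2 \<le> - (1/2) * K + (m\<^sup>2 + m) / (4 * (1 - m\<^sup>2)) * (d + M)"
    if "D\<^sup>2 + K / 2 \<le> C" "4 * (v * C) \<le> (m\<^sup>2 + m) * (d + M)" for C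
  proof -
    have "C \<le> (m\<^sup>2 + m) / (4 * v) * (d + M)" using that(2) v by (simp add: field_simps)
    then show ?thesis using that(1) by (simp add: v_def)
  qed
  have a: "D\<^sup>2 + K / 2 \<le> 5/8 * B" using D by linarith
  have b: "D\<^sup>2 + K / 2 \<le> 3 + B / 4" using D by linarith
  show ?thesis
  proof (cases "4 * (v * (3 + B / 4)) \<le> (m\<^sup>2 + m) * (d + M)")
    case True
    then show ?thesis by (rule cvt[OF b])
  next
    case False
    have "4 * (v * (5/8 * B)) \<le> (m\<^sup>2 + m) * (d + M)"
    proof (cases "m \<le> 2/3")
      \<comment> \<open>Exactly up to \<open>2/3\<close> one has
        \<open>5/2 * m\<^sup>2 \<le> m\<^sup>2 + m\<close>, and then the bound \<open>a\<close>
        suffices for every \<open>M\<close>.\<close>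
      case True
      have "m * m \<le> m * (2/3)" using True m by (intro mult_left_mono) auto
      then have "5/2 * m\<^sup>2 \<le> m\<^sup>2 + m" by (simp add: power2_eq_square)
      then have "5/2 * m\<^sup>2 * (d + M) \<le> (m\<^sup>2 + m) * (d + M)" using d M by (intro mult_right_mono) auto
      moreover have "0 \<le> d * (v * L)" using v L d by (intro mult_nonneg_nonneg) (auto intro: order_trans[OF _ L])
      ultimately show ?thesis using Bv by (simp add: algebra_simps)
    next
      \<comment> \<open>The goal is equivalent to \<open>(3 * m - 2) * (m * M) \<le> d * (2 * m - 3
        * m\<^sup>2 + 5 * v * L)\<close>. It needs an upper bound on \<open>M\<close>, and the
        failure of the bound \<open>b\<close> supplies one.\<close>
      case m23: False
      have "12 * v + (d * (m\<^sup>2 - v * L) + m\<^sup>2 * M) > (m\<^sup>2 + m) * (d + M)"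
        using False Bv by (simp add: algebra_simps)
      then have "m * M < 12 * v - d * v * L - m * d" by (simp add: algebra_simps)
      \<comment> \<open>The assumption \<open>1 \<le> d\<close> makes the upper bound proportional
        to \<open>d\<close>, so that \<open>d\<close> can be factored out.\<close>
      also have "\<dots> \<le> 12 * v * d - d * v * L - m * d" using v d by simp
      finally have 1: "m * M \<le> d * (12 * v - v * L - m)" by (simp add: algebra_simps)
      have "(3 * m - 2) * (m * M) \<le> (3 * m - 2) * (d * (12 * v - v * L - m))"
        using 1 m23 by (intro mult_left_mono) auto
      also have "\<dots> = d * ((3 * m - 2) * (12 * v - v * L - m))" by simp
      also have "\<dots> \<le> d * (2 * m - 3 * m\<^sup>2 + 5 * v * L)"
      proof -
        have "4 * (3 * m - 2) \<le> L * (1 + m)"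
          using ln_one_minus_square_bound[of m] m m23 by (simp add: L_def v_def)
        then have "3 * v * (4 * (3 * m - 2)) \<le> 3 * v * (L * (1 + m))" using v by (intro mult_left_mono) auto
        then have "(3 * m - 2) * (12 * v - v * L - m) \<le> 2 * m - 3 * m\<^sup>2 + 5 * v * L"
          by (simp add: algebra_simps power2_eq_square)
        then show ?thesis using d by (intro mult_left_mono) auto
      qed
      finally show ?thesis using Bv by (simp add: algebra_simps power2_eq_square)
    qed
    then show ?thesis by (rule cvt[OF a])
  qed
qed

section \<open>Isotropic Gaussian densities\<close>

lemma gauss_density_pos: "0 < v \<Longrightarrow> 0 < gauss_density v y"
  by (simp add: gauss_density_def)

lemma gauss_density_nonneg [simp]: "0 \<le> gauss_density v y"
  by (simp add: gauss_density_def)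

lemma borel_measurable_gauss_density [measurable]: "gauss_density v \<in> borel_measurable borel"
  unfolding gauss_density_def[abs_def] by measurable

lemma ln_gauss_density:
  assumes "0 < v"
  shows "ln (gauss_density v (y::real^'d::finite)) = - (real CARD('d) / 2) * ln (2 * pi * v) - (norm y)\<^sup>2 / (2 * v)"
  using assms by (simp add: gauss_density_def ln_mult ln_powr)

lemma norm_square_eq_sum_Basis: "(norm (x::'a::euclidean_space))\<^sup>2 = (\<Sum>b\<in>Basis. (x \<bullet> b)\<^sup>2)"
  unfolding power2_norm_eq_inner by (subst euclidean_inner) (simp add: power2_eq_square)

text \<open>Reduces integrals over the whole space to one-dimensional normal integrals.
  \<open>v\<close> is a variance, whereas \<open>normal_density\<close> takes the standard
  deviation.\<close>

lemma gauss_density_eq_prod: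
  fixes y a :: "real^'d::finite"
  assumes "0 < v"
  shows "gauss_density v (y - a) = (\<Prod>b\<in>Basis. normal_density (a \<bullet> b) (sqrt v) (y \<bullet> b))"
proof -
  have "(\<Prod>b\<in>Basis. normal_density (a \<bullet> b) (sqrt v) (y \<bullet> b))
      = (1 / sqrt (2 * pi * v)) ^ CARD('d) * exp (\<Sum>b\<in>Basis. - (y \<bullet> b - a \<bullet> b)\<^sup>2 / (2 * v))"
    using assms by (simp add: normal_density_def prod.distrib prod_dividef exp_sum power_one_over)
  also have "(\<Sum>b\<in>Basis. - (y \<bullet> b - a \<bullet> b)\<^sup>2 / (2 * v)) = - (norm (y - a))\<^sup>2 / (2 * v)"
    by (simp add: norm_square_eq_sum_Basis inner_diff_left sum_divide_distrib sum_negf)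
  also have "(1 / sqrt (2 * pi * v)) ^ CARD('d) = (2 * pi * v) powr (- real CARD('d) / 2)"
  proof -
    have "1 / sqrt (2 * pi * v) = (2 * pi * v) powr (- (1 / 2))"
      using assms by (simp add: powr_minus powr_half_sqrt field_simps)
    then show ?thesis using assms by (simp add: powr_powr flip: powr_realpow)
  qed
  finally show ?thesis by (simp add: gauss_density_def)
qed

lemma nn_integral_gauss_density:
  fixes a :: "real^'d::finite"
  assumes "0 < v"
  shows "(\<integral>\<^sup>+y. gauss_density v (y - a) \<partial>lborel) = 1"
proof -
  have "(\<integral>\<^sup>+y. gauss_density v (y - a) \<partial>lborel)
      = (\<integral>\<^sup>+y. (\<Prod>b\<in>Basis. ennreal (normal_density (a \<bullet> b) (sqrt v) (y \<bullet> b))) \<partial>lborel)"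
    by (simp add: gauss_density_eq_prod[OF assms] prod_ennreal)
  also have "\<dots> = (\<Prod>b\<in>Basis. (\<integral>\<^sup>+t. normal_density (a \<bullet> b) (sqrt v) t \<partial>lborel))"
    by (rule nn_integral_lborel_prod) auto
  also have "\<dots> = 1" using assms by (simp add: nn_integral_eq_integral)
  finally show ?thesis .
qed

lemma nn_integral_gauss_density_square:
  fixes b :: "real^'d::finite"
  assumes b: "b \<in> Basis"
  shows "(\<integral>\<^sup>+y. ennreal (gauss_density 1 y * (y \<bullet> b)\<^sup>2) \<partial>lborel) = 1"
proof -
  define f :: "real^'d \<Rightarrow> real \<Rightarrow> real" where
    "f c t = std_normal_density t * (if c = b then t\<^sup>2 else 1)" for c t
  have "gauss_density 1 y * (y \<bullet> b)\<^sup>2 = (\<Prod>c\<in>Basis. f c (y \<bullet> c))" for y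
    using gauss_density_eq_prod[of 1 y 0] b by (simp add: f_def prod.distrib)
  then have "(\<integral>\<^sup>+y. ennreal (gauss_density 1 y * (y \<bullet> b)\<^sup>2) \<partial>lborel)
      = (\<integral>\<^sup>+y. (\<Prod>c\<in>Basis. ennreal (f c (y \<bullet> c))) \<partial>lborel)"
    by (simp add: prod_ennreal f_def)
  also have "\<dots> = (\<Prod>c\<in>Basis. (\<integral>\<^sup>+t. f c t \<partial>lborel))"
    by (rule nn_integral_lborel_prod) (auto simp: f_def)
  also have "\<dots> = 1"
  proof (intro prod.neutral ballI)
    fix c
    show "(\<integral>\<^sup>+t. f c t \<partial>lborel) = 1"
    proof (cases "c = b")
      case True
      then show ?thesis
        using std_normal_moment_even[of 1]
        by (simp add: f_def nn_integral_eq_integral has_bochner_integral_iff)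
    next
      case False
      then show ?thesis by (simp add: f_def nn_integral_eq_integral)
    qed
  qed
  finally show ?thesis by simp
qed

definition std_gauss :: "(real^'d::finite) measure" where
  "std_gauss = density lborel (\<lambda>y. ennreal (gauss_density 1 y))"

lemma sets_std_gauss [simp, measurable_cong]: "sets std_gauss = sets borel"
  by (simp add: std_gauss_def)

lemma space_std_gauss [simp]: "space std_gauss = UNIV"
  by (simp add: std_gauss_def)

lemma prob_space_std_gauss: "prob_space (std_gauss :: (real^'d::finite) measure)"
  using nn_integral_gauss_density[of 1 "0 :: real^'d"]
  by (intro prob_spaceI) (simp add: std_gauss_def emeasure_density)

lemma nn_integral_std_gauss_norm_square:
  "(\<integral>\<^sup>+x. ennreal ((norm x)\<^sup>2) \<partial>(std_gauss :: (real^'d::finite) measure)) = CARD('d)"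
proof -
  have "(\<integral>\<^sup>+x. ennreal ((norm x)\<^sup>2) \<partial>(std_gauss :: (real^'d) measure))
      = (\<integral>\<^sup>+x. (\<Sum>b\<in>Basis. ennreal (gauss_density 1 x * (x \<bullet> b)\<^sup>2)) \<partial>(lborel :: (real^'d) measure))"
    by (simp add: std_gauss_def nn_integral_density norm_square_eq_sum_Basis sum_distrib_left
        flip: ennreal_mult sum_ennreal)
  also have "\<dots> = (\<Sum>b\<in>Basis. \<integral>\<^sup>+x. ennreal (gauss_density 1 x * (x \<bullet> b)\<^sup>2) \<partial>(lborel :: (real^'d) measure))"
    by (rule nn_integral_sum) auto
  finally show ?thesis by (simp add: nn_integral_gauss_density_square)
qed

lemma std_gauss_norm_square:
  shows integrable_std_gauss_norm_square:
      "integrable (std_gauss :: (real^'d::finite) measure) (\<lambda>x. (norm x)\<^sup>2)"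
    and integral_std_gauss_norm_square:
      "(LINT x|(std_gauss :: (real^'d) measure). (norm x)\<^sup>2) = real CARD('d)"
proof -
  have "(\<integral>\<^sup>+x. ennreal ((norm x)\<^sup>2) \<partial>(std_gauss :: (real^'d) measure)) = ennreal (real CARD('d))"
    unfolding nn_integral_std_gauss_norm_square by (simp add: ennreal_of_nat_eq_real_of_nat)
  then have "has_bochner_integral (std_gauss :: (real^'d) measure) (\<lambda>x. (norm x)\<^sup>2) (real CARD('d))"
    by (intro has_bochner_integral_nn_integral) auto
  then show "integrable (std_gauss :: (real^'d) measure) (\<lambda>x. (norm x)\<^sup>2)"
      "(LINT x|(std_gauss :: (real^'d) measure). (norm x)\<^sup>2) = real CARD('d)"
    by (simp_all add: has_bochner_integral_iff)
qed

lemma distr_std_gauss_uminus: "distr std_gauss borel uminus = (std_gauss :: (real^'d::finite) measure)"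
proof -
  have "lborel = distr lborel borel (uminus :: real^'d \<Rightarrow> _)"
    using lborel_affine[of "-1" "0 :: real^'d"] by (simp add: density_1 scaleR_minus1_left[abs_def])
  then have "std_gauss = density (distr lborel borel uminus) (\<lambda>y::real^'d. ennreal (gauss_density 1 y))"
    by (simp add: std_gauss_def)
  also have "\<dots> = distr (density lborel (\<lambda>y::real^'d. ennreal (gauss_density 1 (- y)))) borel uminus"
    by (rule density_distr) auto
  finally show ?thesis by (simp add: std_gauss_def gauss_density_def)
qed

text \<open>The reflection \<open>x \<mapsto> - x\<close> preserves \<open>std_gauss\<close>, so the
  integral equals its own negative.\<close>

lemma integral_std_gauss_inner: "(LINT x|(std_gauss :: (real^'d::finite) measure). x \<bullet> y) = 0"
proof -
  have "(LINT x|(std_gauss :: (real^'d) measure). x \<bullet> y) = (LINT x|distr std_gauss borel uminus. x \<bullet> y)"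
    by (simp add: distr_std_gauss_uminus)
  also have "\<dots> = (LINT x|(std_gauss :: (real^'d) measure). - x \<bullet> y)"
    by (rule integral_distr) auto
  finally show ?thesis by simp
qed

section \<open>The Gaussian channel and its posterior law\<close>

lemma norm_diff_scaleR_square:
  "(norm (x - m *\<^sub>R (y::'a::real_inner)))\<^sup>2 = (norm x)\<^sup>2 - 2 * m * (x \<bullet> y) + m\<^sup>2 * (norm y)\<^sup>2"
  by (simp add: power2_norm_eq_inner inner_diff_left inner_diff_right inner_commute[of y x])
    (simp add: power2_eq_square algebra_simps)

text \<open>The gap between the two sides is the square of
  \<open>norm (x + m *\<^sub>R y)\<close>.\<close>

lemma norm_diff_scaleR_square_le:
  "(norm (x - m *\<^sub>R (y::'a::real_inner)))\<^sup>2 \<le> 2 * (norm x)\<^sup>2 + 2 * m\<^sup>2 * (norm y)\<^sup>2"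
proof -
  have "0 \<le> (norm (x - (- m) *\<^sub>R y))\<^sup>2" by (rule zero_le_power2)
  also have "\<dots> = (norm x)\<^sup>2 + 2 * m * (x \<bullet> y) + m\<^sup>2 * (norm y)\<^sup>2"
    unfolding norm_diff_scaleR_square by simp
  finally show ?thesis unfolding norm_diff_scaleR_square by linarith
qed

lemma has_bochner_integral_1I:
  assumes "f \<in> borel_measurable M" "\<And>x. 0 \<le> f x" "(\<integral>\<^sup>+x. ennreal (f x) \<partial>M) = 1"
  shows "integrable M f" "integral\<^sup>L M f = (1::real)"
  using has_bochner_integral_nn_integral[of f M 1] assms by (auto simp: has_bochner_integral_iff)

lemma integral_eq_if_nn_integral_eq:
  assumes "f \<in> borel_measurable M" "g \<in> borel_measurable N" "\<And>x. 0 \<le> f x" "\<And>x. 0 \<le> g x"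
    and "(\<integral>\<^sup>+x. ennreal (f x) \<partial>M) = (\<integral>\<^sup>+x. ennreal (g x) \<partial>N)"
  shows "integral\<^sup>L M f = (integral\<^sup>L N g :: real)"
  using assms by (simp add: integral_eq_nn_integral)

text \<open>The forward process from time 0 to time 1 as a single step: the output is
  \<open>m\<close> times an input of law \<open>\<mu>\<close> plus independent centred Gaussian
  noise of variance \<open>1 - m\<^sup>2\<close> in each coordinate. The noise schedule enters only
  through \<open>m\<close>.\<close>

locale gauss_channel = prob_space \<mu> for \<mu> :: "(real^'d::finite) measure" +
  fixes m :: real
  assumes sets_eq [simp, measurable_cong]: "sets \<mu> = sets borel"
    and m: "0 < m" "m < 1"
    and second_moment: "integrable \<mu> (\<lambda>y. (norm y)\<^sup>2)"
begin

definition kern :: "real^'d \<Rightarrow> real^'d \<Rightarrow> real" where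
  "kern x y = gauss_density (1 - m\<^sup>2) (x - m *\<^sub>R y)"

definition out_density :: "real^'d \<Rightarrow> real" where
  "out_density x = (LINT y|\<mu>. kern x y)"

text \<open>The density with respect to \<open>\<mu>\<close> of the posterior law of the input \<open>y\<close> given the output \<open>x\<close>.\<close>

definition post :: "real^'d \<Rightarrow> real^'d \<Rightarrow> real" where
  "post x y = kern x y / out_density x"

text \<open>The likelihood ratio of the output law and the standard Gaussian law, which serves as
  reference measure for outputs.\<close>

definition lik :: "real^'d \<Rightarrow> real" where
  "lik x = out_density x / gauss_density 1 x"

section \<open>Positivity, bounds and measurability of the channel densities\<close>

lemma space_eq [simp]: "space \<mu> = UNIV"
  using sets_eq_imp_space_eq[OF sets_eq] by simp

lemma var: "0 < 1 - m\<^sup>2"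
  using m by (simp add: abs_square_less_1)

lemma kern_pos: "0 < kern x y"
  unfolding kern_def by (rule gauss_density_pos[OF var])

lemma kern_le: "kern x y \<le> (2 * pi * (1 - m\<^sup>2)) powr (- real CARD('d) / 2)"
  unfolding kern_def gauss_density_def using var by (simp add: mult_left_le)

lemma kern_measurable [measurable]: "(\<lambda>(x, y). kern x y) \<in> borel_measurable (borel \<Otimes>\<^sub>M borel)"
  unfolding kern_def by measurable

lemma kern_integrable: "integrable \<mu> (kern x)"
  by (rule integrable_const_bound[where B = "(2 * pi * (1 - m\<^sup>2)) powr (- real CARD('d) / 2)"])
    (use kern_le kern_pos[THEN less_imp_le] in auto)

lemma out_density_pos: "0 < out_density x"
proof -
  have "0 \<le> out_density x" unfolding out_density_def using kern_pos by (intro integral_nonneg_AE) (auto intro: less_imp_le)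
  moreover have "out_density x \<noteq> 0"
  proof
    assume "out_density x = 0"
    then have "AE y in \<mu>. kern x y = 0"
      using integral_nonneg_eq_0_iff_AE[OF kern_integrable, of x] kern_pos
      by (auto simp: out_density_def intro: less_imp_le)
    then show False using kern_pos[of x] by (auto simp: less_le)
  qed
  ultimately show ?thesis by simp
qed

lemma out_density_le: "out_density x \<le> (2 * pi * (1 - m\<^sup>2)) powr (- real CARD('d) / 2)"
  unfolding out_density_def using kern_le kern_integrable by (intro integral_le_const) auto

lemma out_density_measurable [measurable]: "out_density \<in> borel_measurable borel"
  unfolding out_density_def[abs_def] by measurable

lemma post_pos: "0 < post x y"
  unfolding post_def using kern_pos out_density_pos by simp

lemma post_measurable [measurable]: "(\<lambda>(x, y). post x y) \<in> borel_measurable (borel \<Otimes>\<^sub>M borel)"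
  unfolding post_def by measurable

lemma lik_pos: "0 < lik x"
  by (simp add: lik_def out_density_pos gauss_density_pos)

lemma lik_measurable [measurable]: "lik \<in> borel_measurable borel"
  unfolding lik_def[abs_def] by measurable

text \<open>Bayes' rule, in the form that passes from the reference measure \<open>std_gauss\<close>
  to \<open>lborel\<close>.\<close>

lemma post_lik: "gauss_density 1 x * (post x y * lik x) = kern x y"
  using out_density_pos[of x] gauss_density_pos[of 1 x] by (simp add: post_def lik_def)

lemma nn_integral_kern_fst: "(\<integral>\<^sup>+x. kern x y \<partial>lborel) = 1"
  unfolding kern_def by (rule nn_integral_gauss_density[OF var])

lemma nn_integral_kern_snd: "(\<integral>\<^sup>+y. kern x y \<partial>\<mu>) = ennreal (out_density x)"
  unfolding out_density_def
  by (intro nn_integral_eq_integral AE_I2 less_imp_le kern_integrable kern_pos)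

lemma nn_integral_post: "(\<integral>\<^sup>+y. post x y \<partial>\<mu>) = 1"
proof -
  have "(\<integral>\<^sup>+y. post x y \<partial>\<mu>) = (\<integral>\<^sup>+y. ennreal (1 / out_density x) * ennreal (kern x y) \<partial>\<mu>)"
    using kern_pos out_density_pos
    by (intro nn_integral_cong) (auto simp: post_def less_imp_le simp flip: ennreal_mult)
  also have "\<dots> = ennreal (1 / out_density x) * ennreal (out_density x)"
    by (simp add: nn_integral_cmult nn_integral_kern_snd)
  also have "\<dots> = 1" using out_density_pos[of x] by (simp flip: ennreal_mult)
  finally show ?thesis .
qed

section \<open>The product reference measure and the marginals of the laws on it\<close>

sublocale G: prob_space "std_gauss :: (real^'d) measure"
  by (rule prob_space_std_gauss)

sublocale N: pair_prob_space "std_gauss :: (real^'d) measure" \<mu> ..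

text \<open>Here output and input are independent. Relative to this measure, \<open>post\<close> is
  the density of the law that draws the output from the standard Gaussian and then the input from
  its posterior, while \<open>post\<close> times \<open>lik\<close> is the density of the true law
  of output and input in the channel.\<close>

abbreviation joint :: "((real^'d) \<times> (real^'d)) measure" where
  "joint \<equiv> std_gauss \<Otimes>\<^sub>M \<mu>"

lemma sigma_finite_lborel_pair: "pair_sigma_finite \<mu> (lborel :: (real^'d) measure)" ..

text \<open>The input marginal of the channel law is \<open>\<mu>\<close>: by
  \<open>post_lik\<close> the integrand becomes \<open>kern\<close> with respect to
  \<open>lborel\<close> and \<open>\<mu>\<close>, and after Tonelli the inner integral of
  \<open>kern\<close> over outputs is 1.\<close>

lemma nn_integral_lik_post:
  fixes h :: "real^'d \<Rightarrow> ennreal"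
  assumes [measurable]: "h \<in> borel_measurable borel"
  shows "(\<integral>\<^sup>+z. ennreal (post (fst z) (snd z) * lik (fst z)) * h (snd z) \<partial>joint) = (\<integral>\<^sup>+y. h y \<partial>\<mu>)"
proof -
  interpret L: pair_sigma_finite \<mu> "lborel :: (real^'d) measure" by (rule sigma_finite_lborel_pair)
  have "(\<integral>\<^sup>+z. ennreal (post (fst z) (snd z) * lik (fst z)) * h (snd z) \<partial>joint)
      = (\<integral>\<^sup>+x. \<integral>\<^sup>+y. ennreal (post x y * lik x) * h y \<partial>\<mu> \<partial>std_gauss)"
    by (subst nn_integral_fst[symmetric]) auto
  also have "\<dots> = (\<integral>\<^sup>+x. \<integral>\<^sup>+y. ennreal (kern x y) * h y \<partial>\<mu> \<partial>lborel)"
    unfolding std_gauss_def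
    apply (subst nn_integral_density, measurable)
    apply (intro nn_integral_cong)
    apply (subst nn_integral_cmult[symmetric], measurable)
    apply (intro nn_integral_cong)
    using post_pos lik_pos by (auto simp: post_lik[symmetric] less_imp_le ennreal_mult' ac_simps)
  also have "\<dots> = (\<integral>\<^sup>+y. \<integral>\<^sup>+x. ennreal (kern x y) * h y \<partial>lborel \<partial>\<mu>)"
    by (rule L.Fubini') measurable
  also have "\<dots> = (\<integral>\<^sup>+y. h y \<partial>\<mu>)"
    by (simp add: nn_integral_multc nn_integral_kern_fst)
  finally show ?thesis .
qed

lemma nn_integral_joint_post: "(\<integral>\<^sup>+z. post (fst z) (snd z) \<partial>joint) = 1"
  by (subst nn_integral_fst[symmetric]) (auto simp: nn_integral_post G.emeasure_space_1[simplified])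

lemma nn_integral_joint_post_mult:
  fixes h :: "real^'d \<Rightarrow> ennreal"
  assumes [measurable]: "h \<in> borel_measurable borel"
  shows "(\<integral>\<^sup>+z. ennreal (post (fst z) (snd z)) * h (fst z) \<partial>joint) = (\<integral>\<^sup>+x. h x \<partial>std_gauss)"
  by (subst nn_integral_fst[symmetric]) (auto simp: nn_integral_multc nn_integral_post)

lemma post_joint:
  shows integrable_post: "integrable joint (\<lambda>z. post (fst z) (snd z))"
    and integral_post: "(LINT z|joint. post (fst z) (snd z)) = 1"
  using post_pos by (auto intro!: has_bochner_integral_1I nn_integral_joint_post less_imp_le)

lemma integrable_lik_post: "integrable joint (\<lambda>z. post (fst z) (snd z) * lik (fst z))"
  using nn_integral_lik_post[of "\<lambda>_. 1"] post_pos lik_pos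
  by (intro has_bochner_integral_1I) (auto simp: emeasure_space_1[simplified] less_imp_le)

text \<open>The mass of \<open>post\<close> times \<open>lik\<close> is computed twice: integrating
  over inputs first leaves the integral of \<open>lik\<close>, integrating over outputs first leaves
  the mass of \<open>\<mu>\<close>.\<close>

lemma lik_std_gauss:
  shows integrable_lik: "integrable std_gauss lik" and integral_lik: "(LINT x|std_gauss. lik x) = 1"
proof -
  have "(\<integral>\<^sup>+x. lik x \<partial>std_gauss) = 1"
    using nn_integral_joint_post_mult[of lik] nn_integral_lik_post[of "\<lambda>_. 1"] post_pos lik_pos
    by (simp add: emeasure_space_1[simplified] ennreal_mult' less_imp_le)
  then show "integrable std_gauss lik" "(LINT x|std_gauss. lik x) = 1"
    using lik_pos by (auto intro!: has_bochner_integral_1I less_imp_le)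
qed

lemma integral_fst_joint:
  fixes f :: "real^'d \<Rightarrow> real"
  assumes "integrable std_gauss f"
  shows "integrable joint (\<lambda>z. f (fst z))" "(LINT z|joint. f (fst z)) = (LINT x|std_gauss. f x)"
proof -
  have [measurable]: "f \<in> borel_measurable borel"
    using borel_measurable_integrable[OF assms] by simp
  show "(LINT z|joint. f (fst z)) = (LINT x|std_gauss. f x)"
    by (subst (2) distr_pair_fst[symmetric, of std_gauss], subst integral_distr) auto
  show "integrable joint (\<lambda>z. f (fst z))"
    using assms by (subst (asm) distr_pair_fst[symmetric, of std_gauss]) (simp add: integrable_distr_eq)
qed

lemma integral_snd_joint:
  fixes f :: "real^'d \<Rightarrow> real"
  assumes "integrable \<mu> f"
  shows "integrable joint (\<lambda>z. f (snd z))" "(LINT z|joint. f (snd z)) = (LINT y|\<mu>. f y)"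
proof -
  have [measurable]: "f \<in> borel_measurable borel"
    using borel_measurable_integrable[OF assms] by simp
  have d: "distr joint \<mu> snd = \<mu>"
  proof (rule measure_eqI)
    fix A assume A: "A \<in> sets (distr joint \<mu> snd)"
    then have "snd -` A \<inter> space joint = space std_gauss \<times> A" by (auto simp: space_pair_measure)
    then show "emeasure (distr joint \<mu> snd) A = emeasure \<mu> A"
      using A by (simp add: emeasure_distr emeasure_pair_measure_Times G.emeasure_space_1[simplified])
  qed simp
  show "(LINT z|joint. f (snd z)) = (LINT y|\<mu>. f y)"
    by (subst (2) d[symmetric], subst integral_distr) auto
  show "integrable joint (\<lambda>z. f (snd z))"
    using assms by (subst (asm) d[symmetric]) (simp add: integrable_distr_eq)
qed

section \<open>Logarithms of the densities and relative entropy\<close>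

lemma integrable_norm_diff_square: "integrable \<mu> (\<lambda>y. (norm (x - m *\<^sub>R y))\<^sup>2)"
proof (rule Bochner_Integration.integrable_bound)
  show "integrable \<mu> (\<lambda>y. 2 * (norm x)\<^sup>2 + 2 * m\<^sup>2 * (norm y)\<^sup>2)"
    using second_moment by simp
qed (use norm_diff_scaleR_square_le[of x m] in auto)

lemma ln_kern:
  "ln (kern x y) = - (real CARD('d) / 2) * ln (2 * pi * (1 - m\<^sup>2)) - (norm (x - m *\<^sub>R y))\<^sup>2 / (2 * (1 - m\<^sup>2))"
  unfolding kern_def by (rule ln_gauss_density[OF var])

lemma ln_post: "ln (post x y) = ln (kern x y) - ln (out_density x)"
  unfolding post_def by (rule ln_divide_pos[OF kern_pos out_density_pos])

lemma integrable_ln_kern: "integrable \<mu> (\<lambda>y. ln (kern x y))"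
  unfolding ln_kern using integrable_norm_diff_square by simp

text \<open>Jensen's inequality for the logarithm, obtained from \<open>ln t \<le> t - 1\<close> at
  \<open>t = post x y\<close>, since \<open>post x\<close> has mean 1.\<close>

lemma ln_out_density_ge: "expectation (\<lambda>y. ln (kern x y)) \<le> ln (out_density x)"
proof -
  have "expectation (\<lambda>y. ln (kern x y)) - ln (out_density x) = expectation (\<lambda>y. ln (post x y))"
    using integrable_ln_kern by (simp add: ln_post prob_space[simplified])
  also have "\<dots> \<le> expectation (\<lambda>y. post x y - 1)"
  proof (rule integral_mono)
    show "integrable \<mu> (\<lambda>y. ln (post x y))" unfolding ln_post using integrable_ln_kern by simp
    show "integrable \<mu> (\<lambda>y. post x y - 1)" unfolding post_def using kern_integrable by simp
  qed (use ln_le_minus_one[OF post_pos] in auto)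
  also have "\<dots> = 0"
    using kern_integrable[of x] out_density_pos[of x]
    by (simp add: post_def prob_space[simplified] flip: out_density_def)
  finally show ?thesis by simp
qed

text \<open>The uniform bound on \<open>kern\<close> gives a constant upper bound for the logarithm,
  and Jensen's inequality gives a lower bound quadratic in \<open>x\<close>. The Gaussian law
  integrates both.\<close>

lemma integrable_ln_out_density: "integrable std_gauss (\<lambda>x. ln (out_density x))"
proof (rule Bochner_Integration.integrable_bound)
  let ?M = "expectation (\<lambda>y. (norm y)\<^sup>2)"
  let ?c = "real CARD('d) / 2 * ln (2 * pi * (1 - m\<^sup>2))"
  show "integrable std_gauss (\<lambda>x::real^'d. \<bar>?c\<bar> + (2 * (norm x)\<^sup>2 + 2 * m\<^sup>2 * ?M) / (2 * (1 - m\<^sup>2)))"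
    using integrable_std_gauss_norm_square[where 'd = 'd] by simp
  have "\<bar>ln (out_density x)\<bar> \<le> \<bar>?c\<bar> + (2 * (norm x)\<^sup>2 + 2 * m\<^sup>2 * ?M) / (2 * (1 - m\<^sup>2))" for x
  proof -
    have "ln (out_density x) \<le> ln ((2 * pi * (1 - m\<^sup>2)) powr (- real CARD('d) / 2))"
      using out_density_le[of x] out_density_pos[of x] by (rule ln_mono)
    then have up: "ln (out_density x) \<le> - ?c" using var by (simp add: ln_powr)
    have "expectation (\<lambda>y. (norm (x - m *\<^sub>R y))\<^sup>2) \<le> expectation (\<lambda>y. 2 * (norm x)\<^sup>2 + 2 * m\<^sup>2 * (norm y)\<^sup>2)"
      using second_moment norm_diff_scaleR_square_le
      by (intro integral_mono integrable_norm_diff_square) auto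
    also have "\<dots> = 2 * (norm x)\<^sup>2 + 2 * m\<^sup>2 * ?M"
      using second_moment by (simp add: prob_space[simplified])
    finally have "expectation (\<lambda>y. (norm (x - m *\<^sub>R y))\<^sup>2) / (2 * (1 - m\<^sup>2))
        \<le> (2 * (norm x)\<^sup>2 + 2 * m\<^sup>2 * ?M) / (2 * (1 - m\<^sup>2))"
      using var by (intro divide_right_mono) auto
    moreover have "- ?c - expectation (\<lambda>y. (norm (x - m *\<^sub>R y))\<^sup>2) / (2 * (1 - m\<^sup>2)) \<le> ln (out_density x)"
      using ln_out_density_ge[of x] integrable_norm_diff_square
      by (simp add: ln_kern prob_space[simplified])
    moreover have "0 \<le> (2 * (norm x)\<^sup>2 + 2 * m\<^sup>2 * ?M) / (2 * (1 - m\<^sup>2))"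
      using var by (intro divide_nonneg_pos add_nonneg_nonneg mult_nonneg_nonneg integral_nonneg_AE) auto
    ultimately show ?thesis using up by linarith
  qed
  then show "AE x in std_gauss. norm (ln (out_density x))
      \<le> norm (\<bar>?c\<bar> + (2 * (norm x)\<^sup>2 + 2 * m\<^sup>2 * ?M) / (2 * (1 - m\<^sup>2)))"
    unfolding real_norm_def by (intro AE_I2 order_trans[OF _ abs_ge_self])
qed measurable

lemma ln_std_gauss_density:
  "ln (gauss_density 1 (x::real^'d)) = - (real CARD('d) / 2) * ln (2 * pi) - (norm x)\<^sup>2 / 2"
  by (simp add: ln_gauss_density)

lemma ln_lik: "ln (lik x) = ln (out_density x) - ln (gauss_density 1 x)"
  unfolding lik_def by (rule ln_divide_pos[OF out_density_pos gauss_density_pos]) simp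

lemma integrable_ln_lik: "integrable std_gauss (\<lambda>x. ln (lik x))"
  unfolding ln_lik ln_std_gauss_density
  using integrable_ln_out_density integrable_std_gauss_norm_square[where 'd = 'd] by simp

definition KL :: real where
  "KL = (LINT x|std_gauss. - ln (lik x))"

lemma KL_eq_D_KL:
  "D_KL std_gauss (density lborel (\<lambda>x. ennreal (out_density x))) = KL"
proof -
  have nz: "out_density x \<noteq> 0" for x using out_density_pos[of x] by simp
  have "D_KL std_gauss (density lborel (\<lambda>x. ennreal (out_density x)))
      = (LINT x|lborel. gauss_density 1 x * log (exp 1) (gauss_density 1 x / out_density x))"
    unfolding D_KL_def std_gauss_def
    by (rule lborel.KL_density_density) (simp_all add: nz out_density_pos less_imp_le)
  also have "\<dots> = (LINT x|lborel. gauss_density 1 x * (- ln (lik x)))"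
  proof (intro Bochner_Integration.integral_cong refl)
    fix x :: "real^'d"
    have "ln (gauss_density 1 x / out_density x) = - ln (lik x)"
      unfolding ln_lik by (subst ln_divide_pos[OF gauss_density_pos out_density_pos]) simp_all
    then show "gauss_density 1 x * log (exp 1) (gauss_density 1 x / out_density x) = gauss_density 1 x * (- ln (lik x))"
      by (simp add: log_def)
  qed
  also have "\<dots> = KL"
    unfolding KL_def std_gauss_def by (subst integral_density) auto
  finally show ?thesis .
qed

text \<open>The cross term vanishes: for each fixed \<open>y\<close> the mean of
  \<open>x \<bullet> y\<close> under the centred Gaussian is 0.\<close>

lemma joint_norm_diff_square:
  shows integrable_joint_norm_diff_square:
      "integrable joint (\<lambda>z. (norm (fst z - m *\<^sub>R snd z))\<^sup>2)"
    and integral_joint_norm_diff_square: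
      "(LINT z|joint. (norm (fst z - m *\<^sub>R snd z))\<^sup>2)
        = real CARD('d) + m\<^sup>2 * expectation (\<lambda>y. (norm y)\<^sup>2)"
proof -
  note sq1 = integral_fst_joint[OF integrable_std_gauss_norm_square]
  note sq2 = integral_snd_joint[OF second_moment]
  show int: "integrable joint (\<lambda>z. (norm (fst z - m *\<^sub>R snd z))\<^sup>2)"
  proof (rule Bochner_Integration.integrable_bound)
    show "integrable joint (\<lambda>z. 2 * (norm (fst z))\<^sup>2 + 2 * m\<^sup>2 * (norm (snd z))\<^sup>2)"
      using sq1(1) sq2(1) by simp
  qed (use norm_diff_scaleR_square_le[of _ m] in auto)
  have inner: "integrable joint (\<lambda>z. fst z \<bullet> snd z)"
  proof (rule Bochner_Integration.integrable_bound)
    show "integrable joint (\<lambda>z. (norm (fst z))\<^sup>2 + (norm (snd z))\<^sup>2)"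
      using sq1(1) sq2(1) by simp
    have "\<bar>x \<bullet> y\<bar> \<le> (norm x)\<^sup>2 + (norm y)\<^sup>2" for x y :: "real^'d"
    proof -
      have "\<bar>x \<bullet> y\<bar> \<le> norm x * norm y" by (rule Cauchy_Schwarz_ineq2)
      also have "\<dots> \<le> 2 * norm x * norm y" by simp
      also have "\<dots> \<le> (norm x)\<^sup>2 + (norm y)\<^sup>2" by (rule sum_squares_bound)
      finally show ?thesis .
    qed
    then show "AE z in joint. norm (fst z \<bullet> snd z) \<le> norm ((norm (fst z))\<^sup>2 + (norm (snd z))\<^sup>2)"
      by auto
  qed measurable
  have "(LINT z|joint. fst z \<bullet> snd z) = (LINT y|\<mu>. LINT x|std_gauss. x \<bullet> y)"
    using N.integral_snd[of "\<lambda>x y. x \<bullet> y"] inner by (simp add: case_prod_unfold)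
  also have "\<dots> = 0" by (simp add: integral_std_gauss_inner)
  finally have "(LINT z|joint. fst z \<bullet> snd z) = 0" .
  then show "(LINT z|joint. (norm (fst z - m *\<^sub>R snd z))\<^sup>2)
      = real CARD('d) + m\<^sup>2 * expectation (\<lambda>y. (norm y)\<^sup>2)"
    unfolding norm_diff_scaleR_square
    using inner sq1 sq2 by (simp add: integral_std_gauss_norm_square)
qed

text \<open>\<open>ln (post x y)\<close> is \<open>- ln (lik x)\<close> plus a constant and two
  quadratic terms with known means. The first summand has mean \<open>KL\<close>, hence the negative
  sign of \<open>KL\<close> after negation.\<close>

lemma ln_post_joint:
  shows integrable_ln_post: "integrable joint (\<lambda>z. ln (post (fst z) (snd z)))"
    and integral_ln_post: "(LINT z|joint. - ln (post (fst z) (snd z))) = - KL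
      + (real CARD('d) * (ln (1 - m\<^sup>2) + m\<^sup>2 / (1 - m\<^sup>2))
        + m\<^sup>2 * expectation (\<lambda>y. (norm y)\<^sup>2) / (1 - m\<^sup>2)) / 2"
proof -
  define c where "c = real CARD('d) / 2 * ln (1 - m\<^sup>2)"
  have eq: "ln (post x y) = - ln (lik x) + (norm x)\<^sup>2 / 2 - c - (norm (x - m *\<^sub>R y))\<^sup>2 / (2 * (1 - m\<^sup>2))" for x y
  proof -
    have "ln (2 * pi * (1 - m\<^sup>2)) = ln (2 * pi) + ln (1 - m\<^sup>2)" using var by (intro ln_mult_pos) auto
    then show ?thesis
      unfolding ln_post ln_lik ln_std_gauss_density ln_kern c_def by (simp add: algebra_simps)
  qed
  note a = integral_fst_joint[OF integrable_ln_lik]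
  note b = integral_fst_joint[OF integrable_std_gauss_norm_square]
  show "integrable joint (\<lambda>z. ln (post (fst z) (snd z)))"
    unfolding eq using a(1) b(1) integrable_joint_norm_diff_square by simp
  have split: "(LINT z|joint. - ln (post (fst z) (snd z)))
      = - KL - real CARD('d) / 2 + c
        + (real CARD('d) + m\<^sup>2 * expectation (\<lambda>y. (norm y)\<^sup>2)) / (2 * (1 - m\<^sup>2))"
    unfolding eq KL_def
    using a b integrable_joint_norm_diff_square integral_joint_norm_diff_square
    by (simp add: integral_std_gauss_norm_square N.prob_space[simplified])
  show "(LINT z|joint. - ln (post (fst z) (snd z))) = - KL
      + (real CARD('d) * (ln (1 - m\<^sup>2) + m\<^sup>2 / (1 - m\<^sup>2))
        + m\<^sup>2 * expectation (\<lambda>y. (norm y)\<^sup>2) / (1 - m\<^sup>2)) / 2"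
  proof -
    \<comment> \<open>Stated for letters with \<open>u = 1 - v\<close>, so that the simplifier
      treats \<open>1 - m\<^sup>2\<close> as one nonzero denominator.\<close>
    have "- k - d / 2 + d / 2 * l + (d + u * e) / (2 * v) = - k + (d * (l + u / v) + u * e / v) / 2"
      if "0 < v" "u = 1 - v" for k d l u v e :: real
      unfolding that(2) using that(1) by (simp add: field_simps)
    from this[of "1 - m\<^sup>2" "m\<^sup>2"] show ?thesis
      unfolding split c_def using var by simp
  qed
qed

section \<open>Bias of bounded test functions under the posterior mixture\<close>

lemma integral_lik_post:
  fixes f :: "real^'d \<Rightarrow> real"
  assumes [measurable]: "f \<in> borel_measurable borel" and f: "\<And>y. \<bar>f y\<bar> \<le> 1"
  shows "integrable joint (\<lambda>z. f (snd z) * (post (fst z) (snd z) * lik (fst z)))"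
    and "(LINT z|joint. f (snd z) * (post (fst z) (snd z) * lik (fst z))) = expectation f"
proof -
  let ?w = "\<lambda>z. post (fst z) (snd z) * lik (fst z)"
  have w: "0 \<le> ?w z" for z
    using post_pos[of "fst z" "snd z"] lik_pos[of "fst z"] by simp
  have intf: "integrable \<mu> f"
    using f by (intro integrable_const_bound[where B = 1]) auto
  show int: "integrable joint (\<lambda>z. f (snd z) * ?w z)"
  proof (rule Bochner_Integration.integrable_bound[OF integrable_lik_post])
    show "AE z in joint. norm (f (snd z) * ?w z) \<le> norm (?w z)"
      using mult_right_mono[OF f, of "\<bar>?w z\<bar>" for z] by (intro AE_I2) (simp add: abs_mult)
  qed measurable
  \<comment> \<open>The marginal identity is available for nonnegative integrands, so
    \<open>f\<close> is shifted by 1; the shift contributes mass 1 on both sides and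
    cancels.\<close>
  have nn: "0 \<le> 1 + f y" for y using f[of y] by linarith
  have "(\<integral>\<^sup>+z. ennreal (?w z * (1 + f (snd z))) \<partial>joint) = (\<integral>\<^sup>+y. ennreal (1 + f y) \<partial>\<mu>)"
    using nn_integral_lik_post[of "\<lambda>y. ennreal (1 + f y)"] by (simp only: ennreal_mult'[OF w]) simp
  then have "(LINT z|joint. ?w z * (1 + f (snd z))) = expectation (\<lambda>y. 1 + f y)"
    by (intro integral_eq_if_nn_integral_eq mult_nonneg_nonneg nn w) simp_all
  moreover have "(LINT z|joint. ?w z) = 1"
    using nn_integral_lik_post[of "\<lambda>_. 1"] w
    by (intro has_bochner_integral_1I(2)) (simp_all add: emeasure_space_1[simplified])
  ultimately show "(LINT z|joint. f (snd z) * ?w z) = expectation f"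
    using int intf integrable_lik_post
    by (simp add: distrib_left prob_space[simplified] mult.commute[of _ "f _"])
qed

lemma integral_post_mult_fst:
  fixes h :: "real^'d \<Rightarrow> real"
  assumes [measurable]: "h \<in> borel_measurable borel" and h: "\<And>x. 0 \<le> h x"
  shows "(LINT z|joint. post (fst z) (snd z) * h (fst z)) = (LINT x|std_gauss. h x)"
proof (rule integral_eq_if_nn_integral_eq)
  show "(\<integral>\<^sup>+z. ennreal (post (fst z) (snd z) * h (fst z)) \<partial>joint) = (\<integral>\<^sup>+x. ennreal (h x) \<partial>std_gauss)"
    using nn_integral_joint_post_mult[of "\<lambda>x. ennreal (h x)"]
    by (simp only: ennreal_mult'[OF post_pos[THEN less_imp_le]]) simp
  show "0 \<le> post (fst z) (snd z) * h (fst z)" for z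
    using post_pos[THEN less_imp_le] h by (rule mult_nonneg_nonneg)
  show "(\<lambda>z. post (fst z) (snd z) * h (fst z)) \<in> borel_measurable joint" by measurable
  show "h \<in> borel_measurable std_gauss" by measurable
qed (rule h)

text \<open>Two bounds on the bias of the posterior law of the input when the output is standard
  Gaussian: comparing \<open>\<mu>\<close> with each posterior separately yields a bound that decreases in
  \<open>KL\<close>, data processing yields one that increases in \<open>KL\<close>.\<close>

lemma posterior_mean_bounds:
  fixes f :: "real^'d \<Rightarrow> real"
  assumes [measurable]: "f \<in> borel_measurable borel" and f: "\<And>y. \<bar>f y\<bar> \<le> 1"
  defines "D \<equiv> \<bar>expectation f - (LINT z|joint. post (fst z) (snd z) * f (snd z))\<bar>"
  shows "D \<le> (LINT z|joint. \<bar>1 - post (fst z) (snd z)\<bar>)"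
    and "D \<le> (LINT x|std_gauss. \<bar>1 - lik x\<bar>)"
proof -
  let ?s = "\<lambda>z. post (fst z) (snd z)"
  have s: "integrable joint ?s" "(LINT z|joint. ?s z) = 1" by (rule integrable_post integral_post)+
  have intf: "integrable \<mu> f"
    using f by (intro integrable_const_bound[where B = 1]) auto
  note F = integral_snd_joint[OF intf]
  have absf: "\<bar>f y * t\<bar> \<le> \<bar>t\<bar>" for t y
    using mult_right_mono[OF f, of "\<bar>t\<bar>" y] by (simp add: abs_mult)
  have sf: "integrable joint (\<lambda>z. ?s z * f (snd z))"
  proof (rule Bochner_Integration.integrable_bound[OF s(1)])
    show "AE z in joint. norm (?s z * f (snd z)) \<le> norm (?s z)"
      using absf by (intro AE_I2) (metis mult.commute real_norm_def)
  qed measurable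
  show "D \<le> (LINT z|joint. \<bar>1 - ?s z\<bar>)"
  proof -
    \<comment> \<open>The mean of \<open>f\<close> is written under \<open>joint\<close>, whose
      input marginal is \<open>\<mu>\<close>.\<close>
    have "D = \<bar>LINT z|joint. f (snd z) * (1 - ?s z)\<bar>"
      unfolding D_def using F sf by (simp add: algebra_simps)
    also have "\<dots> \<le> (LINT z|joint. \<bar>f (snd z) * (1 - ?s z)\<bar>)" by (rule integral_abs_bound)
    also have "\<dots> \<le> (LINT z|joint. \<bar>1 - ?s z\<bar>)"
    proof (rule integral_mono)
      show "integrable joint (\<lambda>z. \<bar>f (snd z) * (1 - ?s z)\<bar>)"
        using F sf by (intro integrable_abs) (simp add: algebra_simps)
      show "integrable joint (\<lambda>z. \<bar>1 - ?s z\<bar>)" using s by simp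
      show "\<bar>f (snd z) * (1 - ?s z)\<bar> \<le> \<bar>1 - ?s z\<bar>" for z by (rule absf)
    qed
    finally show ?thesis .
  qed
  show "D \<le> (LINT x|std_gauss. \<bar>1 - lik x\<bar>)"
  proof -
    note sl = integrable_lik_post
    note slf = integral_lik_post[OF assms(1) f]
    \<comment> \<open>Now the same mean is written under the channel law, whose input marginal is
      also \<open>\<mu>\<close>. The factor \<open>post\<close> is common to both terms and
      integrates out to 1 once \<open>f\<close> has been bounded.\<close>
    have "D = \<bar>LINT z|joint. f (snd z) * (?s z * (lik (fst z) - 1))\<bar>"
      unfolding D_def using slf sf by (simp add: algebra_simps)
    also have "\<dots> \<le> (LINT z|joint. \<bar>f (snd z) * (?s z * (lik (fst z) - 1))\<bar>)" by (rule integral_abs_bound)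
    also have "\<dots> \<le> (LINT z|joint. ?s z * \<bar>1 - lik (fst z)\<bar>)"
    proof (rule integral_mono)
      have abs: "?s z * \<bar>1 - lik (fst z)\<bar> = \<bar>?s z * (lik (fst z) - 1)\<bar>" for z
        unfolding abs_mult using post_pos[of "fst z" "snd z"] by (simp add: abs_minus_commute)
      show "integrable joint (\<lambda>z. \<bar>f (snd z) * (?s z * (lik (fst z) - 1))\<bar>)"
        using slf sf by (intro integrable_abs) (simp add: algebra_simps)
      show "integrable joint (\<lambda>z. ?s z * \<bar>1 - lik (fst z)\<bar>)"
        unfolding abs using sl s by (intro integrable_abs) (simp add: algebra_simps)
      show "\<bar>f (snd z) * (?s z * (lik (fst z) - 1))\<bar> \<le> ?s z * \<bar>1 - lik (fst z)\<bar>" for z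
        unfolding abs by (rule absf)
    qed
    also have "\<dots> = (LINT x|std_gauss. \<bar>1 - lik x\<bar>)"
      by (rule integral_post_mult_fst) auto
    finally show ?thesis .
  qed
qed

text \<open>Pinsker's inequality is applied to \<open>lik\<close> under \<open>std_gauss\<close> and
  to \<open>post\<close> under \<open>joint\<close>. Together with the trivial bound 2 on
  \<open>D\<close> this provides the three inputs of \<open>combine_bounds\<close>.\<close>

lemma posterior_mean_bound:
  fixes f :: "real^'d \<Rightarrow> real"
  assumes meas: "f \<in> borel_measurable borel" and f: "\<And>y. \<bar>f y\<bar> \<le> 1"
  defines "D \<equiv> \<bar>expectation f - (LINT z|joint. post (fst z) (snd z) * f (snd z))\<bar>"
  shows "D\<^sup>2 \<le> - (1/2) * KL
    + (m\<^sup>2 + m) / (4 * (1 - m\<^sup>2)) * (real CARD('d) + expectation (\<lambda>y. (norm y)\<^sup>2))"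
proof -
  let ?s = "\<lambda>z. post (fst z) (snd z)"
  let ?M = "expectation (\<lambda>y. (norm y)\<^sup>2)"
  have s: "integrable joint ?s" "(LINT z|joint. ?s z) = 1" by (rule integrable_post integral_post)+
  have D0: "0 \<le> D" by (simp add: D_def)
  have le1: "D \<le> (LINT z|joint. \<bar>1 - ?s z\<bar>)" and le2: "D \<le> (LINT x|std_gauss. \<bar>1 - lik x\<bar>)"
    unfolding D_def by (rule posterior_mean_bounds[OF meas f])+
  have "D \<le> 2"
  proof -
    have "(LINT z|joint. \<bar>1 - ?s z\<bar>) \<le> (LINT z|joint. 1 + ?s z)"
    proof (rule integral_mono)
      show "\<bar>1 - ?s z\<bar> \<le> 1 + ?s z" for z using post_pos[of "fst z" "snd z"] by linarith
    qed (use s in auto)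
    also have "\<dots> = 2" using s by (simp add: N.prob_space[simplified])
    finally show ?thesis using le1 by simp
  qed
  then have "D\<^sup>2 \<le> 2\<^sup>2" using D0 by (rule power_mono)
  then have b1: "D\<^sup>2 \<le> 4" by simp
  have "D\<^sup>2 \<le> (LINT x|std_gauss. \<bar>1 - lik x\<bar>)\<^sup>2" using le2 D0 by (rule power_mono)
  also have "\<dots> \<le> 2 * KL"
    unfolding KL_def by (rule G.pinsker[OF lik_pos integrable_lik integral_lik integrable_ln_lik])
  finally have b2: "D\<^sup>2 \<le> 2 * KL" .
  define B where "B = real CARD('d) * (ln (1 - m\<^sup>2) + m\<^sup>2 / (1 - m\<^sup>2)) + m\<^sup>2 * ?M / (1 - m\<^sup>2)"
  have "D\<^sup>2 \<le> (LINT z|joint. \<bar>1 - ?s z\<bar>)\<^sup>2" using le1 D0 by (rule power_mono)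
  also have "\<dots> \<le> 2 * (LINT z|joint. - ln (?s z))"
    by (rule N.pinsker[OF post_pos s integrable_ln_post])
  also have "(LINT z|joint. - ln (?s z)) = - KL + B / 2"
    unfolding B_def by (rule integral_ln_post)
  finally have b3: "D\<^sup>2 \<le> B - 2 * KL" by simp
  have "1 \<le> real CARD('d)" by (simp add: Suc_leI)
  moreover have "0 \<le> ?M" by (intro integral_nonneg_AE) auto
  ultimately show ?thesis by (rule combine_bounds[OF m _ _ b1 b2 b3 B_def])
qed

end

section \<open>Finite second moment of the data distribution\<close>

definition bump :: "nat \<Rightarrow> real \<Rightarrow> real" where
  "bump j t = (if t > 0 then exp (- 1 / t) / t ^ j else 0)"

lemma power_div_fact_le_exp:
  fixes x :: real
  assumes "0 \<le> x"
  shows "x ^ n / fact n \<le> exp x"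
proof -
  have "(\<Sum>k\<in>{n}. x ^ k /\<^sub>R fact k) \<le> (\<Sum>k. x ^ k /\<^sub>R fact k)"
    using assms summable_exp_generic[of x] by (intro sum_le_suminf) auto
  then show ?thesis by (simp add: exp_def divide_inverse mult.commute)
qed

lemma bump_nonneg: "0 \<le> bump j t"
  by (simp add: bump_def)

lemma bump_0_le_1: "bump 0 t \<le> 1"
  by (simp add: bump_def)

text \<open>The term of order \<open>j + 2\<close> of the exponential series at \<open>1 / t\<close>
  beats the denominator \<open>t ^ j\<close> with a factor \<open>t\<^sup>2\<close> to spare. That
  factor makes the derivative at 0 vanish.\<close>

lemma bump_le_square: "bump j t \<le> fact (j + 2) * t\<^sup>2"
proof (cases "t > 0")
  case True
  have "(1 / t) ^ (j + 2) / fact (j + 2) \<le> exp (1 / t)"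
    using True by (intro power_div_fact_le_exp) simp
  then have "exp (- (1 / t)) \<le> fact (j + 2) * t ^ (j + 2)"
    using True by (simp add: exp_minus field_simps del: fact_Suc)
  then show ?thesis
    using True by (simp add: bump_def divide_le_eq power_add power2_eq_square algebra_simps del: fact_Suc)
qed (simp add: bump_def)

text \<open>The powers in the denominator of \<open>bump\<close> exist for this closure property:
  differentiating \<open>exp (- 1 / t) / t ^ j\<close> only raises \<open>j\<close>, so smoothness
  follows by iteration.\<close>

lemma DERIV_bump: "(bump j has_real_derivative bump (j + 2) t - real j * bump (j + 1) t) (at t)"
proof -
  consider "t > 0" | "t < 0" | "t = 0" by linarith
  then show ?thesis
  proof cases
    case 1
    have "((\<lambda>t. exp (- 1 / t) / t ^ j) has_real_derivative
        ((exp (- 1 / t) * (1 / t\<^sup>2)) * t ^ j - exp (- 1 / t) * (real j * t ^ (j - 1))) / (t ^ j * t ^ j)) (at t)"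
      using 1 by (auto intro!: derivative_eq_intros simp: power2_eq_square)
    also have "((exp (- 1 / t) * (1 / t\<^sup>2)) * t ^ j - exp (- 1 / t) * (real j * t ^ (j - 1))) / (t ^ j * t ^ j)
        = bump (j + 2) t - real j * bump (j + 1) t"
      using 1 by (cases j) (simp_all add: bump_def field_simps power2_eq_square)
    finally show ?thesis
      by (rule has_field_derivative_transform_within_open[of _ _ _ "{0<..}"]) (use 1 in \<open>auto simp: bump_def\<close>)
  next
    case 2
    have "((\<lambda>_. 0) has_real_derivative bump (j + 2) t - real j * bump (j + 1) t) (at t)"
      using 2 by (simp add: bump_def)
    then show ?thesis
      by (rule has_field_derivative_transform_within_open[of _ _ _ "{..<0}"]) (use 2 in \<open>auto simp: bump_def\<close>)
  next
    case 3
    have "((\<lambda>h. (bump j (0 + h) - bump j 0) / h) \<longlongrightarrow> 0) (at 0)"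
    proof (rule Lim_null_comparison)
      show "\<forall>\<^sub>F h in at 0. norm ((bump j (0 + h) - bump j 0) / h) \<le> fact (j + 2) * \<bar>h\<bar>"
      proof (rule always_eventually, rule allI)
        fix h :: real
        have "\<bar>bump j h\<bar> \<le> fact (j + 2) * (\<bar>h\<bar> * \<bar>h\<bar>)"
          using bump_le_square[of j h] bump_nonneg[of j h] by (simp add: power2_eq_square del: fact_Suc)
        then have "\<bar>bump j h\<bar> / \<bar>h\<bar> \<le> fact (j + 2) * \<bar>h\<bar>"
          by (cases "h = 0") (simp_all add: divide_le_eq algebra_simps del: fact_Suc)
        then show "norm ((bump j (0 + h) - bump j 0) / h) \<le> fact (j + 2) * \<bar>h\<bar>"
          by (simp add: bump_def[of j 0] abs_divide del: fact_Suc)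
      qed
      show "((\<lambda>h::real. fact (j + 2) * \<bar>h\<bar>) \<longlongrightarrow> 0) (at 0)"
        by (rule tendsto_eq_intros | simp)+
    qed
    then have "(bump j has_real_derivative 0) (at 0)" by (simp add: DERIV_def)
    then show ?thesis using 3 by (simp add: bump_def)
  qed
qed

text \<open>A class of functions supported in the ball of radius \<open>sqrt c\<close> that is closed under partial
  derivatives, hence consists of test functions.\<close>

inductive bump_span :: "real \<Rightarrow> (real^'d::finite \<Rightarrow> real) \<Rightarrow> bool" for c where
  base: "bump_span c (\<lambda>x. bump j (c - (norm x)\<^sup>2))"
| coord: "bump_span c f \<Longrightarrow> bump_span c (\<lambda>x. x $ i * f x)"
| scale: "bump_span c f \<Longrightarrow> bump_span c (\<lambda>x. a * f x)"
| add: "bump_span c f \<Longrightarrow> bump_span c g \<Longrightarrow> bump_span c (\<lambda>x. f x + g x)"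

lemma has_derivative_norm_square:
  "((\<lambda>x::'a::real_inner. (norm x)\<^sup>2) has_derivative (\<lambda>h. 2 * (x \<bullet> h))) (at x)"
  unfolding power2_norm_eq_inner
  by (auto intro!: derivative_eq_intros simp: inner_commute)

lemma bump_span_derivative:
  assumes "bump_span c f"
  shows "\<exists>D. (\<forall>x. (f has_derivative (\<lambda>h. \<Sum>i\<in>UNIV. D i x * h $ i)) (at x)) \<and> (\<forall>i. bump_span c (D i))"
  using assms
proof induction
  case (base j)
  \<comment> \<open>The nesting and the signed scalars follow the introduction rules of
    \<open>bump_span\<close>, so that membership is syntactic.\<close>
  define D :: "'a \<Rightarrow> real^'a \<Rightarrow> real" where
    "D i x = x $ i * ((- 2) * (bump (j + 2) (c - (norm x)\<^sup>2) + (- real j) * bump (j + 1) (c - (norm x)\<^sup>2)))" for i x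
  have "((\<lambda>x. bump j (c - (norm x)\<^sup>2)) has_derivative (\<lambda>h. \<Sum>i\<in>UNIV. D i x * h $ i)) (at x)" for x
  proof -
    let ?t = "c - (norm x)\<^sup>2"
    have "((\<lambda>x. c - (norm x)\<^sup>2) has_derivative (\<lambda>h. - (2 * (x \<bullet> h)))) (at x)"
      by (auto intro!: derivative_eq_intros has_derivative_norm_square)
    from DERIV_compose_FDERIV[OF DERIV_bump this, of j]
    have "((\<lambda>x. bump j (c - (norm x)\<^sup>2)) has_derivative
        (\<lambda>h. - (2 * (x \<bullet> h)) * (bump (j + 2) ?t - real j * bump (j + 1) ?t))) (at x)" .
    also have "(\<lambda>h. - (2 * (x \<bullet> h)) * (bump (j + 2) ?t - real j * bump (j + 1) ?t)) = (\<lambda>h. \<Sum>i\<in>UNIV. D i x * h $ i)"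
      by (auto simp: D_def inner_vec_def sum_distrib_left sum_distrib_right sum_negf[symmetric] algebra_simps
          sum_subtractf[symmetric] sum.distrib[symmetric] intro!: sum.cong)
    finally show ?thesis .
  qed
  moreover have "bump_span c (D i)" for i
    unfolding D_def by (intro bump_span.intros)
  ultimately show ?case by blast
next
  case (coord f i)
  then obtain D where D: "\<And>x. (f has_derivative (\<lambda>h. \<Sum>k\<in>UNIV. D k x * h $ k)) (at x)"
    "\<And>k. bump_span c (D k)" by blast
  \<comment> \<open>The product rule; the Kronecker delta is a scalar factor so that the
    \<open>scale\<close> rule applies.\<close>
  define E where "E k x = (if k = i then 1 else 0) * f x + x $ i * D k x" for k x
  have "((\<lambda>x. x $ i * f x) has_derivative (\<lambda>h. \<Sum>k\<in>UNIV. E k x * h $ k)) (at x)" for x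
  proof -
    have "((\<lambda>x. x $ i * f x) has_derivative (\<lambda>h. x $ i * (\<Sum>k\<in>UNIV. D k x * h $ k) + h $ i * f x)) (at x)"
      by (intro has_derivative_mult D bounded_linear_imp_has_derivative bounded_linear_vec_nth)
    also have "(\<lambda>h. x $ i * (\<Sum>k\<in>UNIV. D k x * h $ k) + h $ i * f x) = (\<lambda>h. \<Sum>k\<in>UNIV. E k x * h $ k)"
    proof (rule ext)
      fix h :: "real^'a"
      have "(\<Sum>k\<in>UNIV. (if k = i then 1 else 0) * f x * h $ k) = (\<Sum>k\<in>UNIV. if k = i then f x * h $ k else 0)"
        by (rule sum.cong) auto
      then show "x $ i * (\<Sum>k\<in>UNIV. D k x * h $ k) + h $ i * f x = (\<Sum>k\<in>UNIV. E k x * h $ k)"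
        by (simp add: E_def distrib_right sum.distrib sum_distrib_left mult.assoc)
    qed
    finally show ?thesis .
  qed
  moreover have "bump_span c (E k)" for k
    unfolding E_def by (intro bump_span.intros coord D)
  ultimately show ?case by blast
next
  case (scale f a)
  then obtain D where D: "\<And>x. (f has_derivative (\<lambda>h. \<Sum>k\<in>UNIV. D k x * h $ k)) (at x)"
    "\<And>k. bump_span c (D k)" by blast
  have "((\<lambda>x. a * f x) has_derivative (\<lambda>h. \<Sum>k\<in>UNIV. (a * D k x) * h $ k)) (at x)" for x
    using has_derivative_mult_right[OF D(1), of a x] by (simp add: sum_distrib_left mult.assoc)
  then show ?case using bump_span.scale[OF D(2)] by (intro exI[of _ "\<lambda>k x. a * D k x"]) blast
next
  case (add f g)
  then obtain D E where D: "\<And>x. (f has_derivative (\<lambda>h. \<Sum>k\<in>UNIV. D k x * h $ k)) (at x)"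
    "\<And>k. bump_span c (D k)"
    and E: "\<And>x. (g has_derivative (\<lambda>h. \<Sum>k\<in>UNIV. E k x * h $ k)) (at x)"
    "\<And>k. bump_span c (E k)" by blast
  have "((\<lambda>x. f x + g x) has_derivative (\<lambda>h. \<Sum>k\<in>UNIV. (D k x + E k x) * h $ k)) (at x)" for x
    using has_derivative_add[OF D(1) E(1), of x] by (simp add: sum.distrib distrib_right)
  then show ?case using bump_span.add[OF D(2) E(2)] by (intro exI[of _ "\<lambda>k x. D k x + E k x"]) blast
qed

lemma partial_deriv_eqI:
  assumes "(f has_derivative (\<lambda>h. \<Sum>k\<in>UNIV. D k * h $ k)) (at x)"
  shows "partial_deriv i f x = D i"
  unfolding partial_deriv_def frechet_derivative_at[OF assms, symmetric]
  by (simp add: axis_def if_distrib cong: if_cong)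

lemma bump_span_C_k: "bump_span c f \<Longrightarrow> C_k k f"
proof (induction k arbitrary: f)
  case 0
  then obtain D where "\<And>x. (f has_derivative (\<lambda>h. \<Sum>k\<in>UNIV. D k x * h $ k)) (at x)"
    using bump_span_derivative by blast
  then show ?case
    by (auto intro!: continuous_at_imp_continuous_on has_derivative_continuous)
next
  case (Suc k)
  then obtain D where D: "\<And>x. (f has_derivative (\<lambda>h. \<Sum>k\<in>UNIV. D k x * h $ k)) (at x)"
    "\<And>k. bump_span c (D k)"
    using bump_span_derivative by blast
  have "partial_deriv i f = D i" for i
    using partial_deriv_eqI[OF D(1)] by (intro ext)
  then show ?case using Suc.IH[OF D(2)] D(1) by (auto simp: differentiable_def)
qed

lemma bump_span_eq_0: "bump_span c f \<Longrightarrow> c \<le> (norm x)\<^sup>2 \<Longrightarrow> f x = 0"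
  by (induction rule: bump_span.induct) (auto simp: bump_def)

lemma bump_span_test_function:
  assumes "bump_span c f"
  shows "test_function f"
proof -
  have "{x. f x \<noteq> 0} \<subseteq> cball 0 (sqrt c)"
  proof
    fix x assume "x \<in> {x. f x \<noteq> 0}"
    then have "(norm x)\<^sup>2 \<le> c" using bump_span_eq_0[OF assms, of x] by force
    then show "x \<in> cball 0 (sqrt c)" by (simp add: real_le_rsqrt)
  qed
  then have "bounded {x. f x \<noteq> 0}" using bounded_cball bounded_subset by blast
  then show ?thesis
    using bump_span_C_k[OF assms] by (simp add: test_function_def)
qed

section \<open>Coercivity and the radial test of the weak gradient\<close>

lemma sym_pos_def_lower_bound:
  fixes Q :: "real^'d::finite^'d"
  assumes "sym_pos_def Q"
  obtains l where "0 < l" "\<And>x. l * (norm x)\<^sup>2 \<le> x \<bullet> (Q *v x)"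
proof -
  \<comment> \<open>The constant is the minimum of the quadratic form on the unit sphere, attained
    by compactness; homogeneity extends the bound to all vectors.\<close>
  have "\<exists>x\<in>sphere 0 1. \<forall>y\<in>sphere (0::real^'d) 1. x \<bullet> (Q *v x) \<le> y \<bullet> (Q *v y)"
  proof (rule continuous_attains_inf)
    have "axis undefined 1 \<in> sphere (0::real^'d) 1" by simp
    then show "sphere (0::real^'d) 1 \<noteq> {}" by blast
    show "continuous_on (sphere 0 1) (\<lambda>x. x \<bullet> (Q *v x))"
      by (intro continuous_intros linear_continuous_on matrix_vector_mul_bounded_linear)
  qed simp
  then obtain z where z: "z \<in> sphere 0 1" "\<And>y. y \<in> sphere 0 1 \<Longrightarrow> z \<bullet> (Q *v z) \<le> y \<bullet> (Q *v y)"
    by blast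
  show thesis
  proof
    have "z \<noteq> 0" using z(1) by auto
    then show "0 < z \<bullet> (Q *v z)" using assms by (simp add: sym_pos_def_def)
    fix x
    show "z \<bullet> (Q *v z) * (norm x)\<^sup>2 \<le> x \<bullet> (Q *v x)"
    proof (cases "x = 0")
      case False
      then have "z \<bullet> (Q *v z) \<le> (x /\<^sub>R norm x) \<bullet> (Q *v (x /\<^sub>R norm x))" by (intro z(2)) simp
      also have "\<dots> = (x \<bullet> (Q *v x)) / (norm x)\<^sup>2"
        by (simp add: matrix_vector_mult_scaleR power2_eq_square divide_inverse)
      finally show ?thesis using False by (simp add: pos_le_divide_eq)
    qed simp
  qed
qed

text \<open>Integration by parts against the field \<open>bump 0 (c - |x|^2) x\<close>. Its
  divergence is at most the dimension, because the cutoff is at most 1 and decreases radially, and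
  \<open>p\<close> has mass 1.\<close>

lemma weak_gradient_radial_bound:
  fixes p :: "real^'d::finite \<Rightarrow> real"
  assumes p: "integrable lborel p" "\<And>x. 0 \<le> p x" "(LINT x|lborel. p x) = 1"
    and g: "is_weak_gradient p g"
  shows "integrable lborel (\<lambda>x. (g x \<bullet> x) * bump 0 (c - (norm x)\<^sup>2))"
    and "- (LINT x|lborel. (g x \<bullet> x) * bump 0 (c - (norm x)\<^sup>2)) \<le> real CARD('d)"
proof -
  let ?b = "\<lambda>j x::real^'d. bump j (c - (norm x)\<^sup>2)"
  define \<psi> :: "'d \<Rightarrow> real^'d \<Rightarrow> real" where "\<psi> i x = x $ i * ?b 0 x" for i x
  have \<psi>: "bump_span c (\<psi> i)" for i unfolding \<psi>_def by (intro bump_span.intros)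
  have int: "integrable lborel (\<lambda>x. g x $ i * \<psi> i x)" for i
  proof -
    let ?K = "cball (0::real^'d) (sqrt c)"
    have gK: "integrable lborel (\<lambda>x. indicator ?K x *\<^sub>R g x)"
      using g by (simp add: is_weak_gradient_def locally_integrable_def set_integrable_def)
    have \<psi>_meas: "\<psi> i \<in> borel_measurable borel"
      using bump_span_C_k[OF \<psi>, of 0] by (auto intro: borel_measurable_continuous_onI)
    have g_meas: "(\<lambda>x. (indicator ?K x *\<^sub>R g x) $ i) \<in> borel_measurable borel"
      using borel_measurable_inner[OF borel_measurable_integrable[OF gK] borel_measurable_const, of "axis i 1"]
      by (simp add: inner_axis)
    \<comment> \<open>\<open>g\<close> is only locally integrable; as \<open>\<psi> i\<close>
      vanishes outside the ball, \<open>g\<close> may be cut off there.\<close>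
    have eq: "g x $ i * \<psi> i x = (indicator ?K x *\<^sub>R g x) $ i * \<psi> i x" for x
    proof (cases "x \<in> ?K")
      case False
      then have "sqrt c \<le> norm x" by simp
      then have "c \<le> (norm x)\<^sup>2" by (rule sqrt_le_D)
      then show ?thesis using bump_span_eq_0[OF \<psi>] by simp
    qed simp
    show ?thesis
      unfolding eq
    proof (rule Bochner_Integration.integrable_bound)
      show "integrable lborel (\<lambda>x. \<bar>sqrt c\<bar> * norm (indicator ?K x *\<^sub>R g x))"
        by (intro integrable_mult_right integrable_norm gK)
      show "AE x in lborel. norm ((indicator ?K x *\<^sub>R g x) $ i * \<psi> i x) \<le> norm (\<bar>sqrt c\<bar> * norm (indicator ?K x *\<^sub>R g x))"
      proof (rule AE_I2)
        fix x :: "real^'d"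
        show "norm ((indicator ?K x *\<^sub>R g x) $ i * \<psi> i x) \<le> norm (\<bar>sqrt c\<bar> * norm (indicator ?K x *\<^sub>R g x))"
        proof (cases "x \<in> ?K")
          case True
          have "\<bar>\<psi> i x\<bar> \<le> \<bar>x $ i\<bar> * 1"
            unfolding \<psi>_def abs_mult using bump_nonneg bump_0_le_1 by (intro mult_left_mono) auto
          also have "\<dots> \<le> \<bar>sqrt c\<bar>" using True component_le_norm_cart[of x i] by simp
          finally have "\<bar>\<psi> i x\<bar> \<le> \<bar>sqrt c\<bar>" .
          then have "\<bar>\<psi> i x\<bar> * \<bar>g x $ i\<bar> \<le> \<bar>sqrt c\<bar> * norm (g x)"
            using component_le_norm_cart[of "g x" i] by (intro mult_mono) auto
          then show ?thesis using True by (simp add: abs_mult mult.commute)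
        qed simp
      qed
      show "(\<lambda>x. (indicator ?K x *\<^sub>R g x) $ i * \<psi> i x) \<in> borel_measurable lborel"
        using borel_measurable_times[OF g_meas \<psi>_meas] by simp
    qed
  qed
  have sum: "(g x \<bullet> x) * ?b 0 x = (\<Sum>i\<in>UNIV. g x $ i * \<psi> i x)" for x
    by (simp add: inner_vec_def \<psi>_def sum_distrib_right mult.assoc)
  show "integrable lborel (\<lambda>x. (g x \<bullet> x) * ?b 0 x)"
    unfolding sum by (intro Bochner_Integration.integrable_sum int)
  have le: "- (LINT x|lborel. g x $ i * \<psi> i x) \<le> 1" for i
  proof -
    have D: "partial_deriv i (\<psi> i) x \<le> 1" for x
    proof -
      have "((\<lambda>x::real^'d. c - (norm x)\<^sup>2) has_derivative (\<lambda>h. - (2 * (x \<bullet> h)))) (at x)"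
        by (auto intro!: derivative_eq_intros has_derivative_norm_square)
      from DERIV_compose_FDERIV[OF DERIV_bump this, of 0]
      have "(?b 0 has_derivative (\<lambda>h. - (2 * (x \<bullet> h)) * ?b 2 x)) (at x)" by (simp add: numeral_2_eq_2)
      then have "(\<psi> i has_derivative (\<lambda>h. x $ i * (- (2 * (x \<bullet> h)) * ?b 2 x) + h $ i * ?b 0 x)) (at x)"
        unfolding \<psi>_def
        by (intro has_derivative_mult bounded_linear_imp_has_derivative bounded_linear_vec_nth)
      from frechet_derivative_at[OF this, symmetric]
      have "partial_deriv i (\<psi> i) x = x $ i * (- (2 * (x \<bullet> axis i 1)) * ?b 2 x) + ?b 0 x"
        by (simp add: partial_deriv_def)
      also have "\<dots> = ?b 0 x - 2 * ((x $ i)\<^sup>2 * ?b 2 x)"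
        by (simp add: inner_axis power2_eq_square)
      also have "\<dots> \<le> ?b 0 x" using bump_nonneg by simp
      also have "\<dots> \<le> 1" by (rule bump_0_le_1)
      finally show ?thesis .
    qed
    have "- (LINT x|lborel. g x $ i * \<psi> i x) = (LINT x|lborel. p x * partial_deriv i (\<psi> i) x)"
      using g bump_span_test_function[OF \<psi>] by (simp add: is_weak_gradient_def)
    \<comment> \<open>\<open>integral_mono'\<close> asks only that the dominating function
      \<open>p\<close> be integrable and nonnegative.\<close>
    also have "\<dots> \<le> (LINT x|lborel. p x)"
      using p D by (intro integral_mono') (auto simp: mult_left_le)
    finally show ?thesis using p by simp
  qed
  have "- (LINT x|lborel. (g x \<bullet> x) * ?b 0 x) = (\<Sum>i\<in>UNIV. - (LINT x|lborel. g x $ i * \<psi> i x))"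
    unfolding sum using int by (simp add: sum_negf)
  also have "\<dots> \<le> (\<Sum>i\<in>(UNIV :: 'd set). 1)" by (intro sum_mono le)
  finally show "- (LINT x|lborel. (g x \<bullet> x) * ?b 0 x) \<le> real CARD('d)" by simp
qed

lemma tendsto_bump_0: "(\<lambda>n. bump 0 (real n - a)) \<longlonglongrightarrow> 1"
proof -
  have "((\<lambda>t::real. exp (- inverse t)) \<longlongrightarrow> exp (- 0)) at_top"
    by (intro tendsto_intros tendsto_inverse_0_at_top filterlim_ident)
  moreover have "eventually (\<lambda>t. exp (- inverse t) = bump 0 t) at_top"
    using eventually_gt_at_top[of 0] by eventually_elim (simp add: bump_def divide_inverse)
  ultimately have "(bump 0 \<longlongrightarrow> 1) at_top" by (simp add: filterlim_cong)
  moreover have "filterlim (\<lambda>n. real n - a) at_top sequentially"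
    using filterlim_tendsto_add_at_top[OF tendsto_const[of "- a"] filterlim_real_sequentially] by simp
  ultimately show ?thesis by (rule filterlim_compose)
qed

text \<open>Testing the weak gradient with the compactly supported field \<open>x \<mapsto> bump 0 (c - |x|\<^sup>2) x\<close>
  bounds the second moment truncated by the bump, uniformly in \<open>c\<close>: where \<open>p > 0\<close> the radial
  component of the gradient is at most \<open>p (c0 |x| - l |x|\<^sup>2)\<close>, and \<open>p\<close> vanishes only inside
  the ball of radius \<open>c0 / l\<close>.\<close>

lemma condition_A_second_moment:
  fixes \<mu> :: "(real^'d::finite) measure"
  assumes A: "condition_A \<mu> p g H Q c0" and prob: "prob_space \<mu>"
  shows "integrable \<mu> (\<lambda>x. (norm x)\<^sup>2)"
proof -
  have [measurable]: "p \<in> borel_measurable borel" and p0: "\<And>x. 0 \<le> p x"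
    and \<mu>: "\<mu> = density lborel (\<lambda>x. ennreal (p x))"
    and g: "is_weak_gradient p g" and c0: "c0 > 0"
    and AE: "AE x in lborel. norm (log_hess p g H x) + norm (log_grad p g x + Q *v x) \<le> c0"
    and "sym_pos_def Q"
    using A by (auto simp: condition_A_def)
  then obtain l where l: "0 < l" "\<And>x. l * (norm x)\<^sup>2 \<le> x \<bullet> (Q *v x)"
    using sym_pos_def_lower_bound by blast
  have "(\<integral>\<^sup>+x. ennreal (p x) \<partial>lborel) = 1"
    using prob_space.emeasure_space_1[OF prob] by (simp add: \<mu> emeasure_density)
  then have "has_bochner_integral lborel p 1"
    using p0 by (intro has_bochner_integral_nn_integral) auto
  then have p1: "integrable lborel p" "(LINT x|lborel. p x) = 1" by (simp_all add: has_bochner_integral_iff)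
  define R where "R = c0 / l"
  have R: "0 < R" using c0 l by (simp add: R_def)
  have gR: "integrable lborel (\<lambda>x. indicator (cball 0 R) x *\<^sub>R g x)"
    using g by (simp add: is_weak_gradient_def locally_integrable_def set_integrable_def)
  \<comment> \<open>An integrable error term independent of the cutoff: the first summand serves the
    points where \<open>p\<close> vanishes, the second those where it is positive.\<close>
  define E where "E x = R * norm (indicator (cball 0 R) x *\<^sub>R g x) + c0\<^sup>2 / (2 * l) * p x" for x
  have intE: "integrable lborel E"
    unfolding E_def by (intro Bochner_Integration.integrable_add integrable_mult_right integrable_norm gR p1)
  have E0: "0 \<le> E x" for x unfolding E_def using R l p0 by simp
  let ?b = "\<lambda>c x::real^'d. bump 0 (c - (norm x)\<^sup>2)"
  have pw: "AE x in lborel. l / 2 * (p x * ?b c x * (norm x)\<^sup>2) \<le> - (g x \<bullet> x * ?b c x) + E x" for c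
    using AE
  proof eventually_elim
    fix x
    assume "norm (log_hess p g H x) + norm (log_grad p g x + Q *v x) \<le> c0"
    then have *: "norm (log_grad p g x + Q *v x) \<le> c0"
      by (rule order_trans[rotated]) simp
    have b: "0 \<le> ?b c x" "?b c x \<le> 1" by (rule bump_nonneg bump_0_le_1)+
    have cs: "(log_grad p g x + Q *v x) \<bullet> x \<le> c0 * norm x"
      using norm_cauchy_schwarz[of "log_grad p g x + Q *v x" x] mult_right_mono[OF *, of "norm x"] by simp
    show "l / 2 * (p x * ?b c x * (norm x)\<^sup>2) \<le> - (g x \<bullet> x * ?b c x) + E x"
    proof (cases "p x > 0")
      case True
      then have "(g x \<bullet> x) / p x + x \<bullet> (Q *v x) \<le> c0 * norm x"
        using cs by (simp add: log_grad_def inner_add_left inner_add_right inner_commute divide_inverse mult.commute)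
      then have 1: "(g x \<bullet> x) / p x \<le> c0 * norm x - l * (norm x)\<^sup>2" using l(2)[of x] by linarith
      \<comment> \<open>Young's inequality absorbs the linear term \<open>c0 * norm x\<close> into
        half of the quadratic one.\<close>
      have "0 \<le> (l * norm x - c0)\<^sup>2" by simp
      then have "2 * (l * norm x * c0) \<le> l\<^sup>2 * (norm x)\<^sup>2 + c0\<^sup>2"
        by (simp add: power2_diff power_mult_distrib)
      then have "c0 * norm x \<le> l / 2 * (norm x)\<^sup>2 + c0\<^sup>2 / (2 * l)"
        using l(1) by (simp add: field_simps power2_eq_square)
      with 1 have "(g x \<bullet> x) / p x \<le> c0\<^sup>2 / (2 * l) - l / 2 * (norm x)\<^sup>2" by simp
      then have "g x \<bullet> x \<le> (c0\<^sup>2 / (2 * l) - l / 2 * (norm x)\<^sup>2) * p x"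
        using True by (simp add: pos_divide_le_eq)
      then have "g x \<bullet> x * ?b c x \<le> (c0\<^sup>2 / (2 * l) - l / 2 * (norm x)\<^sup>2) * p x * ?b c x"
        using b(1) by (rule mult_right_mono)
      also have "\<dots> = c0\<^sup>2 / (2 * l) * p x * ?b c x - l / 2 * (p x * ?b c x * (norm x)\<^sup>2)"
        by (simp add: algebra_simps)
      also have "c0\<^sup>2 / (2 * l) * p x * ?b c x \<le> c0\<^sup>2 / (2 * l) * p x"
        using b l(1) p0[of x] by (intro mult_left_le) auto
      also have "\<dots> \<le> E x" using R by (simp add: E_def)
      finally show ?thesis by simp
    next
      case False
      then have p: "p x = 0" using p0[of x] by simp
      \<comment> \<open>Here \<open>log_grad\<close> is 0 by convention, so condition (A) bounds
        \<open>Q *v x\<close> alone and confines \<open>x\<close> to the ball of radius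
        \<open>R\<close>.\<close>
      then have "x \<bullet> (Q *v x) \<le> c0 * norm x" using cs by (simp add: log_grad_def inner_commute)
      then have "l * norm x * norm x \<le> c0 * norm x" using l(2)[of x] by (simp add: power2_eq_square mult.assoc)
      then have "norm x \<le> R"
        using l(1) c0 R by (cases "x = 0") (simp_all add: R_def pos_le_divide_eq mult.commute)
      have "g x \<bullet> x * ?b c x \<le> norm (g x) * norm x * ?b c x"
        using b(1) norm_cauchy_schwarz by (rule mult_right_mono[rotated])
      also have "\<dots> \<le> norm (g x) * norm x" using b(2) by (intro mult_left_le) auto
      also have "\<dots> \<le> R * norm (g x)" using \<open>norm x \<le> R\<close> by (subst mult.commute) (rule mult_right_mono, auto)
      also have "\<dots> = E x" using \<open>norm x \<le> R\<close> p by (simp add: E_def)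
      finally show ?thesis using p by simp
    qed
  qed
  define C where "C = 2 / l * (real CARD('d) + (LINT x|lborel. E x))"
  have C0: "0 \<le> C" unfolding C_def using l(1) E0 by (intro mult_nonneg_nonneg add_nonneg_nonneg integral_nonneg_AE) auto
  have bound: "(\<integral>\<^sup>+x. ennreal (p x * ?b c x * (norm x)\<^sup>2) \<partial>lborel) \<le> ennreal C" for c
  proof -
    note G = weak_gradient_radial_bound[OF p1(1) p0 p1(2) g, of c]
    have [measurable]: "bump 0 \<in> borel_measurable borel" unfolding bump_def[abs_def] by measurable
    have int: "integrable lborel (\<lambda>x. p x * ?b c x * (norm x)\<^sup>2)"
    proof (rule Bochner_Integration.integrable_bound)
      show "integrable lborel (\<lambda>x. p x * \<bar>c\<bar>)" using p1 by simp
      have "?b c x * (norm x)\<^sup>2 \<le> \<bar>c\<bar>" for x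
      proof (cases "(norm x)\<^sup>2 < c")
        case True
        then show ?thesis using mult_mono[OF bump_0_le_1[of "c - (norm x)\<^sup>2"], of "(norm x)\<^sup>2" "\<bar>c\<bar>"] by simp
      qed (simp add: bump_def)
      then show "AE x in lborel. norm (p x * ?b c x * (norm x)\<^sup>2) \<le> norm (p x * \<bar>c\<bar>)"
        using p0 bump_nonneg by (intro AE_I2) (simp add: abs_mult mult.assoc mult_left_mono)
    qed measurable
    have "l / 2 * (LINT x|lborel. p x * ?b c x * (norm x)\<^sup>2) = (LINT x|lborel. l / 2 * (p x * ?b c x * (norm x)\<^sup>2))"
      by simp
    also have "\<dots> \<le> (LINT x|lborel. - (g x \<bullet> x * ?b c x) + E x)"
      using int G(1) intE pw by (intro integral_mono_AE) auto
    also have "\<dots> = - (LINT x|lborel. g x \<bullet> x * ?b c x) + (LINT x|lborel. E x)"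
      using G(1) intE by simp
    also have "\<dots> \<le> real CARD('d) + (LINT x|lborel. E x)" using G(2) by simp
    finally have "(LINT x|lborel. p x * ?b c x * (norm x)\<^sup>2) \<le> C"
      using l(1) by (simp add: C_def field_simps)
    moreover have "(\<integral>\<^sup>+x. ennreal (p x * ?b c x * (norm x)\<^sup>2) \<partial>lborel) = ennreal (LINT x|lborel. p x * ?b c x * (norm x)\<^sup>2)"
      using int p0 bump_nonneg by (intro nn_integral_eq_integral) auto
    ultimately show ?thesis by (simp add: ennreal_leI)
  qed
  have [measurable]: "bump 0 \<in> borel_measurable borel" unfolding bump_def[abs_def] by measurable
  have "(\<integral>\<^sup>+x. ennreal ((norm x)\<^sup>2) \<partial>\<mu>) = (\<integral>\<^sup>+x. ennreal (p x * (norm x)\<^sup>2) \<partial>lborel)"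
    using p0 by (simp add: \<mu> nn_integral_density ennreal_mult')
  also have "\<dots> = (\<integral>\<^sup>+x. liminf (\<lambda>n. ennreal (p x * ?b (real n) x * (norm x)\<^sup>2)) \<partial>lborel)"
  proof (intro nn_integral_cong)
    fix x :: "real^'d"
    have "(\<lambda>n. ennreal (p x * ?b (real n) x * (norm x)\<^sup>2)) \<longlonglongrightarrow> ennreal (p x * 1 * (norm x)\<^sup>2)"
      by (intro tendsto_ennrealI tendsto_intros tendsto_bump_0)
    from lim_imp_Liminf[OF sequentially_bot this]
    show "ennreal (p x * (norm x)\<^sup>2) = liminf (\<lambda>n. ennreal (p x * ?b (real n) x * (norm x)\<^sup>2))"
      by simp
  qed
  \<comment> \<open>Fatou's lemma removes the cutoff, since \<open>C\<close> does not depend on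
    \<open>n\<close>.\<close>
  also have "\<dots> \<le> liminf (\<lambda>n. \<integral>\<^sup>+x. ennreal (p x * ?b (real n) x * (norm x)\<^sup>2) \<partial>lborel)"
    by (rule nn_integral_liminf) measurable
  also have "\<dots> \<le> ennreal C"
    using Liminf_mono[of "\<lambda>n. \<integral>\<^sup>+x. ennreal (p x * ?b (real n) x * (norm x)\<^sup>2) \<partial>lborel" "\<lambda>_. ennreal C" sequentially] bound
    by (simp add: Liminf_const)
  finally show ?thesis
    by (intro integrableI_bounded) (auto simp: \<mu> intro: le_less_trans)
qed

section \<open>The reverse process started from the standard Gaussian\<close>

text \<open>Matches the reversed clock \<open>1 - u\<close> in \<open>reverse_kernel\<close> with
  the forward clock in \<open>mean_factor\<close>.\<close>

lemma reflect_unit_interval_integral: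
  fixes f :: "real \<Rightarrow> real"
  shows "(LINT u:{0..1}|lborel. f (1 - u)) = (LINT u:{0..1}|lborel. f u)"
proof -
  have "(LINT u:{0..1}|lborel. f u) = (LINT u|lborel. indicator {0..1} (1 + - 1 * u) *\<^sub>R f (1 + - 1 * u))"
    unfolding set_lebesgue_integral_def by (subst lborel_integral_real_affine[of "-1" _ 1]) simp_all
  also have "\<dots> = (LINT u:{0..1}|lborel. f (1 - u))"
    unfolding set_lebesgue_integral_def
    by (intro Bochner_Integration.integral_cong) (auto simp: indicator_def)
  finally show ?thesis ..
qed

text \<open>On times in \<open>(0, 1]\<close> the rate takes values in the finite set
  \<open>S\<close> of positive numbers, so it is integrable and its integral is at least
  \<open>Min S\<close>.\<close>

lemma mean_factor_unit_interval:
  assumes n: "n \<ge> 1" and \<alpha>: "\<forall>i\<in>{1..n}. 0 < \<alpha> i \<and> \<alpha> i < 1"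
  shows "0 < mean_factor n \<alpha> 0 1" "mean_factor n \<alpha> 0 1 < 1"
proof -
  define S where "S = (\<lambda>i. - real n * ln (\<alpha> i)) ` {1..n}"
  have S: "finite S" "S \<noteq> {}" using n by (auto simp: S_def)
  have Spos: "0 < s" if "s \<in> S" for s
    using that n \<alpha> by (auto simp: S_def mult_neg_neg ln_less_zero_iff mult_less_0_iff)
  have noise: "noise_rate n \<alpha> t \<in> S" if "0 < t" "t \<le> 1" for t
  proof -
    have "0 < real n * t" "real n * t \<le> real n" using that n by auto
    then have "nat \<lceil>real n * t\<rceil> \<in> {1..n}" by (auto simp: le_nat_iff ceiling_le_iff)
    then show ?thesis
      unfolding S_def by (rule image_eqI[rotated]) (use that in \<open>simp add: noise_rate_def\<close>)
  qed
  have noise0: "noise_rate n \<alpha> 0 = 0" by (simp add: noise_rate_def)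
  have meas: "noise_rate n \<alpha> \<in> borel_measurable borel"
    unfolding noise_rate_def[abs_def] by measurable
  have int: "integrable lborel (\<lambda>u. indicator {0..1} u *\<^sub>R noise_rate n \<alpha> u)"
  proof (rule Bochner_Integration.integrable_bound)
    show "integrable lborel (\<lambda>u::real. indicator {0..1} u *\<^sub>R Max S)" by simp
    have "\<bar>noise_rate n \<alpha> u\<bar> \<le> Max S" if "0 < u" "u \<le> 1" for u
      using noise[OF that] Spos[OF noise[OF that]] S by (simp add: Max_ge)
    then have "norm (indicator {0..1} u *\<^sub>R noise_rate n \<alpha> u) \<le> norm (indicator {0..1} u *\<^sub>R Max S)" for u :: real
      by (cases "0 < u \<and> u \<le> 1"; cases "u = 0") (auto simp: noise0 not_less intro: order_trans[OF _ abs_ge_self])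
    then show "AE u in lborel. norm (indicator {0..1} u *\<^sub>R noise_rate n \<alpha> u) \<le> norm (indicator {0..1} u *\<^sub>R Max S)"
      by simp
  qed (use meas in simp)
  \<comment> \<open>The interval is open at 0 because \<open>noise_rate\<close> has the default
    value 0 there.\<close>
  have "Min S = (LINT u|lborel. indicator {0<..1::real} u *\<^sub>R Min S)" by simp
  also have "\<dots> \<le> (LINT u|lborel. indicator {0..1} u *\<^sub>R noise_rate n \<alpha> u)"
  proof (rule integral_mono[OF _ int])
    show "integrable lborel (\<lambda>u::real. indicator {0<..1} u *\<^sub>R Min S)" by simp
    show "indicator {0<..1} u *\<^sub>R Min S \<le> indicator {0..1} u *\<^sub>R noise_rate n \<alpha> u" for u :: real
      using noise[of u] S noise0 by (auto simp: indicator_def)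
  qed
  finally have "0 < (LINT u:{0..1}|lborel. noise_rate n \<alpha> u)"
    using Spos[OF Min_in[OF S]] by (simp add: set_lebesgue_integral_def)
  then show "mean_factor n \<alpha> 0 1 < 1" by (simp add: mean_factor_def)
  show "0 < mean_factor n \<alpha> 0 1" by (simp add: mean_factor_def)
qed

section \<open>Total variation distance to the mixture of posteriors\<close>

context gauss_channel
begin

text \<open>The hypothesis on sets identifies \<open>\<nu>\<close> as the input marginal of the law
  with density \<open>post\<close>, which gives the formula for all measurable \<open>f\<close> at
  once.\<close>

lemma posterior_law_integral:
  fixes f :: "real^'d \<Rightarrow> real"
  assumes \<nu>: "prob_space \<nu>" "sets \<nu> = sets borel"
    and law: "\<And>B. B \<in> sets borel \<Longrightarrow> measure \<nu> B = (LINT x|std_gauss. LINT y|\<mu>. indicator B y * post x y)"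
    and [measurable]: "f \<in> borel_measurable borel"
  shows "(LINT y|\<nu>. f y) = (LINT z|joint. post (fst z) (snd z) * f (snd z))"
proof -
  interpret \<nu>: prob_space \<nu> by fact
  let ?D = "density joint (\<lambda>z. ennreal (post (fst z) (snd z)))"
  have "\<nu> = distr ?D borel snd"
  proof (rule measure_eqI)
    fix B assume "B \<in> sets \<nu>"
    then have [measurable]: "B \<in> sets borel" by (simp add: \<nu>)
    have nn: "0 \<le> indicator B y * post x y" for x y using post_pos[of x y] by simp
    have int: "integrable joint (\<lambda>z. indicator B (snd z) * post (fst z) (snd z))"
    proof (rule Bochner_Integration.integrable_bound[OF integrable_post])
      show "AE z in joint. norm (indicator B (snd z) * post (fst z) (snd z)) \<le> norm (post (fst z) (snd z))"
        by (intro AE_I2) (simp add: indicator_def)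
    qed measurable
    have "measure \<nu> B = (LINT z|joint. indicator B (snd z) * post (fst z) (snd z))"
      unfolding law[OF \<open>B \<in> sets borel\<close>]
      using N.integral_fst'[OF int] by simp
    then have "emeasure \<nu> B = (\<integral>\<^sup>+z. ennreal (indicator B (snd z) * post (fst z) (snd z)) \<partial>joint)"
      using nn by (simp add: \<nu>.emeasure_eq_measure nn_integral_eq_integral[OF int])
    also have "\<dots> = (\<integral>\<^sup>+z. ennreal (post (fst z) (snd z)) * indicator (snd -` B \<inter> space joint) z \<partial>joint)"
      by (intro nn_integral_cong) (auto simp: indicator_def)
    also have "\<dots> = emeasure ?D (snd -` B \<inter> space joint)"
      by (subst emeasure_density) measurable
    also have "\<dots> = emeasure (distr ?D borel snd) B"
      by (subst emeasure_distr) auto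
    finally show "emeasure \<nu> B = emeasure (distr ?D borel snd) B" .
  qed (simp add: \<nu>)
  then have "(LINT y|\<nu>. f y) = (LINT z|?D. f (snd z))"
    by (simp add: integral_distr)
  also have "\<dots> = (LINT z|joint. post (fst z) (snd z) * f (snd z))"
    using post_pos[THEN less_imp_le] by (subst integral_density) auto
  finally show ?thesis .
qed

lemma D_TV_posterior_law_le:
  assumes \<nu>: "prob_space \<nu>" "sets \<nu> = sets borel"
    and law: "\<And>B. B \<in> sets borel \<Longrightarrow> measure \<nu> B = (LINT x|std_gauss. LINT y|\<mu>. indicator B y * post x y)"
  shows "D_TV \<mu> \<nu> \<le> sqrt (- (1/2) * KL
    + (m\<^sup>2 + m) / (4 * (1 - m\<^sup>2)) * (real CARD('d) + expectation (\<lambda>y. (norm y)\<^sup>2)))"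
  unfolding D_TV_def
proof (rule cSUP_least)
  show "{f \<in> borel_measurable borel. \<forall>x. \<bar>f x\<bar> \<le> 1} \<noteq> ({} :: (real^'d \<Rightarrow> real) set)"
    by (auto intro!: exI[of _ "\<lambda>_. 0"])
  fix f :: "real^'d \<Rightarrow> real" assume "f \<in> {f \<in> borel_measurable borel. \<forall>x. \<bar>f x\<bar> \<le> 1}"
  then have f: "f \<in> borel_measurable borel" "\<And>x. \<bar>f x\<bar> \<le> 1" by auto
  show "\<bar>(LINT x|\<mu>. f x) - (LINT x|\<nu>. f x)\<bar> \<le> sqrt (- (1/2) * KL
    + (m\<^sup>2 + m) / (4 * (1 - m\<^sup>2)) * (real CARD('d) + expectation (\<lambda>y. (norm y)\<^sup>2)))"
  proof (rule real_le_rsqrt)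
    have "(LINT x|\<nu>. f x) = (LINT z|joint. post (fst z) (snd z) * f (snd z))"
      by (rule posterior_law_integral) (use \<nu> law f in auto)
    then show "\<bar>(LINT x|\<mu>. f x) - (LINT x|\<nu>. f x)\<bar>\<^sup>2 \<le> - (1/2) * KL
        + (m\<^sup>2 + m) / (4 * (1 - m\<^sup>2)) * (real CARD('d) + expectation (\<lambda>y. (norm y)\<^sup>2))"
      using posterior_mean_bound[OF f] by simp
  qed
qed

end

text \<open>The exponential prefactor equals \<open>1 / m ^ CARD('d)\<close> and cancels the same
  power in \<open>reverse_q\<close>. Pulling \<open>m\<close> into the norm turns the remaining
  Gaussian into the forward kernel from \<open>y\<close> to \<open>x\<close>, and the density ratio
  supplies \<open>p y\<close> and the normalisation.\<close>

lemma reverse_kernel_eq_posterior: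
  fixes x y :: "real^'d::finite"
  assumes mf: "mean_factor n \<alpha> 0 1 = m" "0 < m" "m < 1" and ch: "gauss_channel \<mu> m"
  shows "forward_density n \<alpha> \<mu> p 1 x = gauss_channel.out_density \<mu> m x"
    and "reverse_kernel n \<alpha> \<mu> p 0 x 1 y = p y * gauss_channel.post \<mu> m x y"
proof -
  interpret gauss_channel \<mu> m by (rule ch)
  have std: "(std_factor n \<alpha> 0 1)\<^sup>2 = 1 - m\<^sup>2"
    using var by (simp add: std_factor_def mf(1))
  show fd: "forward_density n \<alpha> \<mu> p 1 x = out_density x" for x
    by (simp add: forward_density_def forward_kernel_def out_density_def kern_def std mf(1))
  let ?I = "LINT u:{0..1}|lborel. noise_rate n \<alpha> u"
  have "exp (real CARD('d) / 2 * ?I) * m ^ CARD('d) = 1"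
    by (simp add: mf(1)[symmetric] mean_factor_def flip: exp_of_nat_mult exp_add)
  moreover have "reverse_q n \<alpha> 0 x 1 y = m ^ CARD('d) * kern x y"
  proof -
    have "(norm (x - m *\<^sub>R y))\<^sup>2 = m\<^sup>2 * (norm (y - x /\<^sub>R m))\<^sup>2"
    proof -
      have "x - m *\<^sub>R y = (- m) *\<^sub>R (y - x /\<^sub>R m)" using m by (simp add: scaleR_diff_right)
      then show ?thesis by (simp only: norm_scaleR power_mult_distrib) simp
    qed
    then show ?thesis
      using var by (simp add: reverse_q_def Let_def mf(1) std kern_def gauss_density_def powr_minus field_simps)
  qed
  ultimately show "reverse_kernel n \<alpha> \<mu> p 0 x 1 y = p y * post x y"
    using fd[of x] by (simp add: reverse_kernel_def reflect_unit_interval_integral forward_density_def[of _ _ _ _ 0] post_def)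
qed

text \<open>The tower property: the conditional probability given \<open>F 0\<close> has the same
  mean as the event, and it depends on the path through \<open>X 0\<close> only, whose law is
  standard Gaussian.\<close>

lemma transition_density_marginal:
  fixes X :: "real \<Rightarrow> 'b \<Rightarrow> real^'d::finite"
  assumes P: "prob_space P" and F: "subalgebra P (F 0)"
    and td: "has_transition_density P F X k"
    and X0: "distributed P lborel (X 0) (\<lambda>y. ennreal (gauss_density 1 y))"
    and X1: "X 1 \<in> borel_measurable P"
    and B: "B \<in> sets borel"
    and meas: "(\<lambda>x. LINT y:B|lborel. k 0 x 1 y) \<in> borel_measurable borel"
  shows "measure (distr P borel (X 1)) B = (LINT x|std_gauss. (LINT y:B|lborel. k 0 x 1 y))"
proof -
  interpret prob_space P by (rule P)
  interpret finite_measure_subalgebra P "F 0" by unfold_locales (rule F)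
  have [measurable]: "X 0 \<in> borel_measurable P" using distributed_measurable[OF X0] by simp
  note [measurable] = X1 B meas
  have dX0: "distr P borel (X 0) = std_gauss"
    using distributed_distr_eq_density[OF X0] by (simp add: std_gauss_def cong: distr_cong)
  have int: "integrable P (\<lambda>\<omega>. indicator B (X 1 \<omega>) :: real)"
    by (rule integrable_const_bound[where B = 1]) (auto simp: indicator_def)
  have "measure (distr P borel (X 1)) B = (LINT \<omega>|P. indicator B (X 1 \<omega>))"
    using integral_distr[of "X 1" P borel "indicator B :: _ \<Rightarrow> real"] by simp
  also have "\<dots> = (LINT \<omega>|P. real_cond_exp P (F 0) (\<lambda>\<omega>'. indicator B (X 1 \<omega>')) \<omega>)"
    using real_cond_exp_int(2)[OF int] by simp
  also have "\<dots> = (LINT \<omega>|P. (LINT y:B|lborel. k 0 (X 0 \<omega>) 1 y))"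
  proof (rule integral_cong_AE)
    show "(\<lambda>\<omega>. LINT y:B|lborel. k 0 (X 0 \<omega>) 1 y) \<in> borel_measurable P"
      by (rule measurable_compose[OF _ meas]) simp
    show "AE \<omega> in P. real_cond_exp P (F 0) (\<lambda>\<omega>'. indicator B (X 1 \<omega>')) \<omega> = (LINT y:B|lborel. k 0 (X 0 \<omega>) 1 y)"
      using td B by (simp add: has_transition_density_def)
  qed simp
  also have "\<dots> = (LINT x|distr P borel (X 0). (LINT y:B|lborel. k 0 x 1 y))"
    by (rule integral_distr[symmetric]) simp_all
  finally show ?thesis by (simp add: dX0)
qed

theorem theorem2:
  fixes n :: nat and \<alpha> :: "nat \<Rightarrow> real"
    and P :: "'a measure" and x0 :: "'a \<Rightarrow> real^'d::finite"
    and \<mu> :: "(real^'d) measure" and p_data :: "real^'d \<Rightarrow> real"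
    and g :: "real^'d \<Rightarrow> real^'d" and H :: "real^'d \<Rightarrow> real^'d^'d"
    and Q :: "real^'d^'d" and c0 c1 :: real
    and z :: "nat \<Rightarrow> real^'d \<Rightarrow> real^'d"
    and P' :: "'b measure" and F :: "real \<Rightarrow> 'b measure"
    and W X :: "real \<Rightarrow> 'b \<Rightarrow> real^'d" and p1_star :: "real^'d \<Rightarrow> real"
  assumes "n \<ge> 1" and "\<forall>i\<in>{1..n}. 0 < \<alpha> i \<and> \<alpha> i < 1"
    and "prob_space P" and "complete_measure P"
    and "prob_space \<mu>" and "sets \<mu> = sets borel"
    and "x0 \<in> borel_measurable P" and "distr P borel x0 = \<mu>"
    and "condition_A \<mu> p_data g H Q c0"
    and "c1 > 0" and "\<forall>l v. v \<noteq> 0 \<and> Q *v v = l *\<^sub>R v \<longrightarrow> l < c1"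
    and "condition_B n \<alpha> z c0 c1"
    and "reverse_weak_solution n \<alpha> \<mu> p_data g P' F W X"
    and "has_transition_density P' F X (reverse_kernel n \<alpha> \<mu> p_data)"
    and "\<forall>y. 0 \<le> p1_star y"
    and "distributed P' lborel (X 1) (\<lambda>y. ennreal (p1_star y))"
  shows "D_TV \<mu> (density lborel (\<lambda>y. ennreal (p1_star y)))
    \<le> sqrt (- (1/2) * D_KL (density lborel (\<lambda>y. ennreal (gauss_density 1 y)))
                            (density lborel (\<lambda>y. ennreal (forward_density n \<alpha> \<mu> p_data 1 y)))
            + ((mean_factor n \<alpha> 0 1)\<^sup>2 + mean_factor n \<alpha> 0 1) / (4 * (1 - (mean_factor n \<alpha> 0 1)\<^sup>2))
              * (real CARD('d) + prob_space.expectation P (\<lambda>\<omega>. (norm (x0 \<omega>))\<^sup>2)))"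
proof -
  define m where "m = mean_factor n \<alpha> 0 1"
  have mf: "mean_factor n \<alpha> 0 1 = m" "0 < m" "m < 1"
    using mean_factor_unit_interval[OF assms(1,2)] by (simp_all add: m_def)
  have ch: "gauss_channel \<mu> m"
    using assms(5,6) mf condition_A_second_moment[OF assms(9,5)]
    by (intro gauss_channel.intro gauss_channel_axioms.intro) auto
  interpret gauss_channel \<mu> m by (rule ch)
  note kernel = reverse_kernel_eq_posterior[OF mf ch, of p_data]
  have sol: "prob_space P'" "subalgebra P' (F 0)"
      "distributed P' lborel (X 0) (\<lambda>y. ennreal (gauss_density 1 y))"
    using assms(13) by (auto simp: reverse_weak_solution_def filtration_on_def)
  have X1: "X 1 \<in> borel_measurable P'" using distributed_measurable[OF assms(16)] by simp
  have [measurable]: "p_data \<in> borel_measurable borel" and p: "\<And>y. 0 \<le> p_data y"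
    and \<mu>: "\<mu> = density lborel (\<lambda>y. ennreal (p_data y))"
    using assms(9) by (auto simp: condition_A_def)
  let ?\<nu> = "density lborel (\<lambda>y. ennreal (p1_star y))"
  have \<nu>: "?\<nu> = distr P' borel (X 1)"
    using distributed_distr_eq_density[OF assms(16)] by (simp cong: distr_cong)
  have law: "measure ?\<nu> B = (LINT x|std_gauss. LINT y|\<mu>. indicator B y * post x y)"
    if [measurable]: "B \<in> sets borel" for B
  proof -
    \<comment> \<open>The factor \<open>p_data y\<close> of the kernel turns the Lebesgue integral
      into one against \<open>\<mu>\<close>.\<close>
    have k: "(LINT y:B|lborel. reverse_kernel n \<alpha> \<mu> p_data 0 x 1 y) = (LINT y|\<mu>. indicator B y * post x y)" for x
    proof -
      have "(\<lambda>y. indicator B y * post x y) \<in> borel_measurable lborel" by measurable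
      then have "(LINT y|density lborel (\<lambda>y. ennreal (p_data y)). indicator B y * post x y)
          = (LINT y|lborel. p_data y *\<^sub>R (indicator B y * post x y))"
        using p by (intro integral_density) auto
      then show ?thesis unfolding \<mu>[symmetric] by (simp add: set_lebesgue_integral_def kernel mult_ac)
    qed
    show ?thesis
      unfolding \<nu> k[symmetric]
    proof (rule transition_density_marginal[OF sol(1,2) assms(14) sol(3) X1 that])
      show "(\<lambda>x. LINT y:B|lborel. reverse_kernel n \<alpha> \<mu> p_data 0 x 1 y) \<in> borel_measurable borel"
        \<comment> \<open>In the form given by \<open>k\<close>, the integral is one of a jointly
          measurable function, hence measurable in \<open>x\<close>.\<close>
        unfolding k by measurable
    qed
  qed
  have "prob_space ?\<nu>" unfolding \<nu> using sol(1) X1 by (rule prob_space.prob_space_distr)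
  then have "D_TV \<mu> ?\<nu> \<le> sqrt (- (1/2) * KL
      + (m\<^sup>2 + m) / (4 * (1 - m\<^sup>2)) * (real CARD('d) + expectation (\<lambda>y. (norm y)\<^sup>2)))"
    by (rule D_TV_posterior_law_le) (simp_all add: law)
  also have "expectation (\<lambda>y. (norm y)\<^sup>2) = prob_space.expectation P (\<lambda>\<omega>. (norm (x0 \<omega>))\<^sup>2)"
    using assms(7) by (simp add: integral_distr flip: assms(8))
  also have "KL = D_KL (density lborel (\<lambda>y. ennreal (gauss_density 1 y)))
      (density lborel (\<lambda>y. ennreal (forward_density n \<alpha> \<mu> p_data 1 y)))"
    unfolding kernel(1) KL_eq_D_KL[symmetric] std_gauss_def ..
  finally show ?thesis unfolding mf(1) .
qed

end
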